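(* Let $G=(V,E)$ be an unweighted undirected graph with $n=|V|$ vertices and $m=|E|$ edges, and let $\epsilon\in(0,1]$. Let $G_{\epsilon}$ be the weighted graph output by the sparsification algorithm described in the context. Then, with probability at least $1-8/n$, $G_{\epsilon}\in(1\pm\epsilon)G$, i.e. for every cut of $V$ the total weight of the edges of $G_\epsilon$ crossing it lies between $(1-\epsilon)$ and $(1+\epsilon)$ times the number of edges of $G$ crossing it.
   Context: A cut is a partition of $V$ into two nonempty parts; its weight in a weighted graph is the total weight of edges crossing it. For weighted graphs $H,G$ on the same vertex set and $\delta>0$, $H\in(1\pm\delta)G$ means every cut has weight in $H$ between $(1-\delta)$ and $(1+\delta)$ times its weight in $G$. For a set $Z$ of unweighted edges and $c>0$, $cZ$ denotes the edges of $Z$ each with weight $c$. Nagamochi–Ibaraki (NI) forests of a multigraph $H$: edge-disjoint forests $T_1,T_2,\ldots$ partitioning $E(H)$, computed by the Nagamochi–Ibaraki scan-first procedure in $O(|E(H)|+|V(H)|\log|V(H)|)$ time, where $T_j$ is a maximal spanning forest of $H$ minus $T_1\cup\cdots\cup T_{j-1}$, with the property that for every edge $(u,v)\in T_j$, $u$ and $v$ are $j$-edge-connected in $T_1\cup\cdots\cup T_j$. Contracting an edge set merges endpoints, discards resulting self-loops and keeps parallel edges, each surviving edge being identified with its original edge. The algorithm: (1) Let $\rho=\frac{1014\ln n}{0.38\epsilon^2}$. If $m\le 2\rho n$, output $G_\epsilon=G$. (2) Otherwise compute NI forests $T_1,T_2,\ldots$ of $G$; set $X_0=E$, $F_0=\bigcup_{1\le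 j\le 2\rho}T_j$, $Y_0=X_0\setminus F_0$; add each edge of $F_0$ to $G_\epsilon$ with weight 1; set $i=0$. (3) If $|Y_i|\le 2\rho n$, add each edge of $Y_i$ to $G_\epsilon$ with weight $2^i$ and go to (5). Otherwise let $X_{i+1}$ contain each edge of $Y_i$ independently with probability $1/2$, and increase $i$ by 1. (4) Let $k_i=\rho\cdot 2^{i+1}$ and $G_c=(V_c,E_c)=(V,X_i)$. While $|E_c|>2k_i|V_c|$: compute NI forests $T_1,\ldots,T_{k_i+1}$ of $G_c$ and contract all edges of $T_{k_i+1}$ in $G_c$. When $|E_c|\le 2k_i|V_c|$, set $F_i=E_c$ (as a subset of $X_i$), $Y_i=X_i\setminus F_i$, and go to (3). (5) For each $i\ge1$ and each $e\in F_i$, let $p_e=\min\!\big(\frac{3}{169\cdot 2^{2i-9}},1\big)$, draw $r_e\sim\mathrm{Binomial}(2^i,p_e)$ independently, and if $r_e>0$ add $e$ to $G_\epsilon$ with weight $r_e/p_e$. *)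

theory Defs
  imports "HOL-Probability.Probability"
begin

section \<open>Simple graphs, weighted graphs and cuts\<close>

definition simple_graph :: "'a set \<Rightarrow> 'a set set \<Rightarrow> bool" where
  "simple_graph V E \<longleftrightarrow> finite V \<and> (\<forall>e\<in>E. e \<subseteq> V \<and> card e = 2)"

text \<open>A weighted graph on a given vertex set is a partial map from edges to weights;
  its domain is its edge set.\<close>

type_synonym 'a weighted_edges = "'a set \<rightharpoonup> real"

definition add_edges :: "'a set set \<Rightarrow> real \<Rightarrow> 'a weighted_edges \<Rightarrow> 'a weighted_edges" where
  "add_edges Z c W = (\<lambda>e. if e \<in> Z then Some c else W e)"

definition uniform_weight :: "real \<Rightarrow> 'a set set \<Rightarrow> 'a weighted_edges" where
  "uniform_weight c Z = add_edges Z c Map.empty"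

definition crosses :: "'a set \<Rightarrow> 'a set \<Rightarrow> bool" where
  "crosses S e \<longleftrightarrow> e \<inter> S \<noteq> {} \<and> e - S \<noteq> {}"

definition cut_weight :: "'a weighted_edges \<Rightarrow> 'a set \<Rightarrow> real" where
  "cut_weight W S = (\<Sum>e | e \<in> dom W \<and> crosses S e. the (W e))"

definition cut_approx ::
    "'a set \<Rightarrow> real \<Rightarrow> 'a weighted_edges \<Rightarrow> 'a weighted_edges \<Rightarrow> bool" where
  "cut_approx V \<delta> H G \<longleftrightarrow>
     (\<forall>S. S \<noteq> {} \<and> S \<subset> V \<longrightarrow>
        (1 - \<delta>) * cut_weight G S \<le> cut_weight H S \<and>
        cut_weight H S \<le> (1 + \<delta>) * cut_weight G S)"


section \<open>Multigraphs\<close>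

text \<open>Edges carry their own identity, so that parallel edges are distinct and an edge
  keeps its name when its endpoints are merged.  The value of \<open>ends\<close> outside \<open>edges\<close> is
  irrelevant.\<close>

record ('v, 'e) multigraph =
  verts :: "'v set"
  edges :: "'e set"
  ends :: "'e \<Rightarrow> 'v set"

definition loopless_multigraph :: "('v, 'e) multigraph \<Rightarrow> bool" where
  "loopless_multigraph H \<longleftrightarrow> finite (verts H) \<and> finite (edges H) \<and>
     (\<forall>e\<in>edges H. ends H e \<subseteq> verts H \<and> card (ends H e) = 2)"

fun walk :: "('v, 'e) multigraph \<Rightarrow> 'v \<Rightarrow> 'e list \<Rightarrow> 'v \<Rightarrow> bool" where
  "walk H u [] v \<longleftrightarrow> u = v"
| "walk H u (e # es) v \<longleftrightarrow> (\<exists>w. ends H e = {u, w} \<and> walk H w es v)"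

definition connected_in :: "('v, 'e) multigraph \<Rightarrow> 'e set \<Rightarrow> 'v \<Rightarrow> 'v \<Rightarrow> bool" where
  "connected_in H T u v \<longleftrightarrow> (\<exists>es. set es \<subseteq> T \<and> walk H u es v)"

definition edge_connected_in ::
    "('v, 'e) multigraph \<Rightarrow> 'e set \<Rightarrow> nat \<Rightarrow> 'v \<Rightarrow> 'v \<Rightarrow> bool" where
  "edge_connected_in H T j u v \<longleftrightarrow>
     (\<forall>D. D \<subseteq> T \<and> finite D \<and> card D < j \<longrightarrow> connected_in H (T - D) u v)"

text \<open>A forest has no closed trail; equivalently, it has no cycle.\<close>

definition is_forest :: "('v, 'e) multigraph \<Rightarrow> 'e set \<Rightarrow> bool" where
  "is_forest H T \<longleftrightarrow> T \<subseteq> edges H \<and>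
     \<not> (\<exists>u es. es \<noteq> [] \<and> distinct es \<and> set es \<subseteq> T \<and> walk H u es u)"

definition maximal_forest :: "('v, 'e) multigraph \<Rightarrow> 'e set \<Rightarrow> 'e set \<Rightarrow> bool" where
  "maximal_forest H R T \<longleftrightarrow> T \<subseteq> R \<and> is_forest H T \<and>
     (\<forall>T'. T \<subset> T' \<and> T' \<subseteq> R \<longrightarrow> \<not> is_forest H T')"

text \<open>The forests are indexed from 1; the value at 0 is irrelevant.\<close>

definition NI_forests :: "('v, 'e) multigraph \<Rightarrow> (nat \<Rightarrow> 'e set) \<Rightarrow> bool" where
  "NI_forests H T \<longleftrightarrow>
     disjoint_family_on T {1..} \<and> (\<Union>j\<in>{1..}. T j) = edges H \<and>
     (\<forall>j\<ge>1. maximal_forest H (edges H - (\<Union>l\<in>{1..<j}. T l)) (T j)) \<and>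
     (\<forall>j\<ge>1. \<forall>e\<in>T j. \<forall>u v. ends H e = {u, v} \<longrightarrow>
        edge_connected_in H (\<Union>l\<in>{1..j}. T l) j u v)"

text \<open>The Nagamochi--Ibaraki procedure enters only through the guarantees on its output;
  its order of scanning is left unspecified.\<close>

type_synonym ('v, 'e) forest_procedure = "('v, 'e) multigraph \<Rightarrow> nat \<Rightarrow> 'e set"

definition NI_procedure :: "('v, 'e) forest_procedure \<Rightarrow> bool" where
  "NI_procedure NI \<longleftrightarrow> (\<forall>H. loopless_multigraph H \<longrightarrow> NI_forests H (NI H))"

text \<open>Vertices of contracted graphs are blocks of original vertices, starting from
  singletons; contracting \<open>T\<close> unites the blocks of each connected component of \<open>T\<close>.\<close>

type_synonym 'a block_graph = "('a set, 'a set) multigraph"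

definition block_graph :: "'a set \<Rightarrow> 'a set set \<Rightarrow> 'a block_graph" where
  "block_graph V X =
     \<lparr>verts = (\<lambda>v. {v}) ` V, edges = X, ends = (\<lambda>e. (\<lambda>v. {v}) ` e)\<rparr>"

definition merged_block :: "'a block_graph \<Rightarrow> 'a set set \<Rightarrow> 'a set \<Rightarrow> 'a set" where
  "merged_block H T b = \<Union>{c \<in> verts H. connected_in H T b c}"

definition contract :: "'a block_graph \<Rightarrow> 'a set set \<Rightarrow> 'a block_graph" where
  "contract H T =
     \<lparr>verts = merged_block H T ` verts H,
      edges = {e \<in> edges H. card (merged_block H T ` ends H e) = 2},
      ends = (\<lambda>e. merged_block H T ` ends H e)\<rparr>"


section \<open>The sparsification algorithm\<close>

definition rho :: "nat \<Rightarrow> real \<Rightarrow> real" where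
  "rho n \<epsilon> = 1014 * ln (real n) / (0.38 * \<epsilon>\<^sup>2)"

text \<open>The threshold \<open>k\<close> is real, so the last forest with index at most \<open>k + 1\<close> is the one
  contracted.\<close>

partial_function (spmf) contract_loop ::
    "('a set, 'a set) forest_procedure \<Rightarrow> real \<Rightarrow> 'a block_graph \<Rightarrow> 'a block_graph spmf" where
  "contract_loop NI k H =
     (if real (card (edges H)) > 2 * k * real (card (verts H))
      then contract_loop NI k (contract H (NI H (nat \<lfloor>k + 1\<rfloor>)))
      else return_spmf H)"

definition half_sample :: "'a set \<Rightarrow> 'a set pmf" where
  "half_sample Y =
     map_pmf (\<lambda>b. {e \<in> Y. b e}) (Pi_pmf Y False (\<lambda>_. bernoulli_pmf (1 / 2)))"

text \<open>The result holds the final index \<open>i\<close>, the edge sets \<open>F 1, \<dots>, F i\<close> and the final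
  \<open>Y\<close>.  As \<open>i\<close> is increased before compressing, the threshold is \<open>k i = \<rho> * 2 ^ (i + 1)\<close> at the
  new index.\<close>

partial_function (spmf) level_loop ::
    "('a set, 'a set) forest_procedure \<Rightarrow> 'a set \<Rightarrow> real \<Rightarrow> nat \<Rightarrow> (nat \<Rightarrow> 'a set set) \<Rightarrow> 'a set set
      \<Rightarrow> (nat \<times> (nat \<Rightarrow> 'a set set) \<times> 'a set set) spmf" where
  "level_loop NI V \<rho> i F Y =
     (if real (card Y) \<le> 2 * \<rho> * real (card V) then return_spmf (i, F, Y)
      else bind_spmf (spmf_of_pmf (half_sample Y)) (\<lambda>X.
           bind_spmf (contract_loop NI (\<rho> * 2 ^ (Suc i + 1)) (block_graph V X)) (\<lambda>H.
             level_loop NI V \<rho> (Suc i) (F(Suc i := edges H)) (X - edges H))))"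

definition level_prob :: "nat \<Rightarrow> real" where
  "level_prob i = min (3 / (169 * 2 powi (2 * int i - 9))) 1"

text \<open>Resampling treats the levels \<open>i, i - 1, \<dots>, 1\<close> in turn; their edge sets are disjoint.\<close>

primrec resample ::
    "(nat \<Rightarrow> 'a set set) \<Rightarrow> nat \<Rightarrow> 'a weighted_edges \<Rightarrow> 'a weighted_edges pmf" where
  "resample F 0 W = return_pmf W"
| "resample F (Suc i) W =
     bind_pmf (Pi_pmf (F (Suc i)) 0 (\<lambda>_. binomial_pmf (2 ^ Suc i) (level_prob (Suc i)))) (\<lambda>r.
       resample F i (\<lambda>e. if e \<in> F (Suc i) \<and> r e > 0
                          then Some (real (r e) / level_prob (Suc i)) else W e))"

text \<open>Mass missing from the sub-distribution would be the probability of divergence.\<close>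

definition sparsify ::
    "('a set, 'a set) forest_procedure \<Rightarrow> 'a set \<Rightarrow> 'a set set \<Rightarrow> real \<Rightarrow> 'a weighted_edges spmf" where
  "sparsify NI V E \<epsilon> =
     (let \<rho> = rho (card V) \<epsilon> in
      if real (card E) \<le> 2 * \<rho> * real (card V) then return_spmf (uniform_weight 1 E)
      else
        let F0 = (\<Union>j\<in>{j. 1 \<le> j \<and> real j \<le> 2 * \<rho>}. NI (block_graph V E) j)
        in bind_spmf (level_loop NI V \<rho> 0 (\<lambda>_. {}) (E - F0)) (\<lambda>(i, F, Y).
             spmf_of_pmf (resample F i (add_edges Y (2 ^ i) (uniform_weight 1 F0)))))"

end

theory Submission
  imports Defs
begin

text \<open>
  The heart of the proof is a bound on cut projections.  Let every edge of \<open>R\<close> be \<open>k\<close>-heavy in a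
  weighted graph, meaning that every cut crossed by it has weight at least \<open>k\<close>.  Then the cuts of weight
  at most \<open>\<alpha> k\<close> induce at most \<open>n\<^bsup>2 \<alpha>\<^esup>\<close> different subsets of \<open>R\<close>.  Given a family \<open>C\<close> of cuts with distinct
  projections, let the distance of two vertices be the number of cuts in \<open>C\<close> that separate them, and let \<open>D\<close> be the
  least positive distance between endpoints of edges of \<open>R\<close> that are crossed by \<open>C\<close>.  The balls of radius
  below \<open>D / 2\<close> around the \<open>a\<close> classes of such endpoints are disjoint and each has boundary
  weight at least \<open>k\<close>, so that \<open>a D k \<le> 2 \<Sum>\<^sub>S w(S) \<le> 2 \<alpha> k |C|\<close>.  Discarding the \<open>D\<close> cuts that separate a closest
  pair merges two classes and loses only a fraction \<open>2 \<alpha> / a\<close> of \<open>C\<close>, as in Karger's contraction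
  argument, but without splitting off edges.

  Together with a Chernoff bound, a union bound over projections shows that each halving step
  preserves all cuts of \<open>X\<^sub>i\<close> up to a relative error \<open>\<epsilon> / 13 (3 / 4)\<^sup>i\<close>, and that resampling
  level \<open>i\<close> errs by at most \<open>\<epsilon> / 13\<close> relative to a graph \<open>Q\<^sub>i\<close>; the \<open>Q\<^sub>i\<close> add up to at most \<open>7 / 3\<close> of the
  compressed graph.  Each step fails with probability at most \<open>4 / n\<^sup>2\<close>, and there are at most \<open>n\<close> levels.
\<close>

section \<open>Counting cut projections\<close>

definition cut_val :: "('a set \<Rightarrow> real) \<Rightarrow> 'a set set \<Rightarrow> 'a set \<Rightarrow> real" where
  "cut_val q E S = (\<Sum>e | e \<in> E \<and> crosses S e. q e)"

definition separates :: "'a set \<Rightarrow> 'a \<Rightarrow> 'a \<Rightarrow> bool" where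
  "separates S u v \<longleftrightarrow> (u \<in> S) \<noteq> (v \<in> S)"

lemma crosses_doubleton: "crosses S {u, v} \<longleftrightarrow> separates S u v"
  by (auto simp: crosses_def separates_def)

text \<open>Encodes a vertex so that the symmetric difference of two signatures is the set of cuts
  of \<open>C\<close> separating the two vertices. The classes of the counting argument are the
  distinct signatures.\<close>

definition signature :: "'a set set \<Rightarrow> 'a \<Rightarrow> 'a set set" where
  "signature C u = {S \<in> C. u \<in> S}"

text \<open>Restricting to these vertices ensures that every class has a neighbour: the other end of
  the crossed edge has a different signature.\<close>

definition active :: "'a set set \<Rightarrow> 'a set set \<Rightarrow> 'a set" where
  "active R C = \<Union>{e \<in> R. \<exists>S\<in>C. crosses S e}"

definition hamming :: "'a set \<Rightarrow> 'a set \<Rightarrow> nat" where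
  "hamming A B = card ((A - B) \<union> (B - A))"

lemma hamming_commute: "hamming A B = hamming B A"
  by (simp add: hamming_def Un_commute)

lemma hamming_triangle:
  assumes "finite A" "finite B" "finite C"
  shows "hamming A C \<le> hamming A B + hamming B C"
proof -
  have "hamming A C \<le> card (((A - B) \<union> (B - A)) \<union> ((B - C) \<union> (C - B)))"
    unfolding hamming_def by (intro card_mono) (use assms in auto)
  also have "\<dots> \<le> hamming A B + hamming B C"
    unfolding hamming_def by (rule card_Un_le)
  finally show ?thesis .
qed

lemma hamming_signature:
  "hamming (signature C u) (signature C v) = card {S \<in> C. separates S u v}"
  unfolding hamming_def signature_def separates_def by (rule arg_cong[where f=card]) auto

lemma card_between_thresholds:
  "card {r \<in> {..<D}. ((x::nat) \<le> r) \<noteq> (y \<le> r)} = max (min x D) (min y D) - min (min x D) (min y D)"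
proof -
  have "{r \<in> {..<D}. (x \<le> r) \<noteq> (y \<le> r)} = {min (min x D) (min y D)..<max (min x D) (min y D)}"
    by auto
  then show ?thesis by simp
qed

text \<open>A point is closer than \<open>D / 2\<close> to at most one centre, so only a centre near
  \<open>x\<close> and a centre near \<open>y\<close> contribute. A single centre is handled by the
  triangle inequality. Two centres \<sigma> near \<open>x\<close> and \<tau> near \<open>y\<close>
  contribute the two gaps between \<open>D\<close> and their doubled distances to \<open>x\<close>
  and to \<open>y\<close>, and \<open>D\<close> is at most the distance of \<sigma> and \<tau>.
  Doubled distances keep the radii integral.\<close>

lemma disjoint_balls_overlap:
  assumes "finite A" and fin: "\<And>\<sigma>. \<sigma> \<in> A \<Longrightarrow> finite \<sigma>" and "finite x" "finite y"
    and sep: "\<And>\<sigma> \<tau>. \<sigma> \<in> A \<Longrightarrow> \<tau> \<in> A \<Longrightarrow> \<sigma> \<noteq> \<tau> \<Longrightarrow> D \<le> hamming \<sigma> \<tau>"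
  shows "(\<Sum>\<sigma>\<in>A. card {r \<in> {..<D}. (2 * hamming \<sigma> x \<le> r) \<noteq> (2 * hamming \<sigma> y \<le> r)}) \<le> 2 * hamming x y"
    (is "(\<Sum>\<sigma>\<in>A. ?c \<sigma>) \<le> _")
proof -
  define near where "near z = {\<sigma> \<in> A. 2 * hamming \<sigma> z < D}" for z
  have near_unique: "near z = {} \<or> (\<exists>\<sigma>. near z = {\<sigma>})" if "finite z" for z
  proof (rule ccontr)
    assume "\<not> (near z = {} \<or> (\<exists>\<sigma>. near z = {\<sigma>}))"
    then obtain \<sigma> \<tau> where st: "\<sigma> \<in> near z" "\<tau> \<in> near z" "\<sigma> \<noteq> \<tau>" by blast
    then have "D \<le> hamming \<sigma> \<tau>" using sep by (auto simp: near_def)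
    also have "\<dots> \<le> hamming \<sigma> z + hamming \<tau> z"
      using hamming_triangle[of \<sigma> z \<tau>] fin st that by (auto simp: near_def hamming_commute)
    finally show False using st by (auto simp: near_def)
  qed
  have near_sub: "near z \<subseteq> A" for z by (auto simp: near_def)
  have sum_eq: "(\<Sum>\<sigma>\<in>A. ?c \<sigma>) = (\<Sum>\<sigma>\<in>near x \<union> near y. ?c \<sigma>)"
  proof (rule sum.mono_neutral_right)
    show "finite A" by fact
    show "near x \<union> near y \<subseteq> A" by (auto simp: near_def)
    show "\<forall>\<sigma>\<in>A - (near x \<union> near y). ?c \<sigma> = 0"
      by (auto simp: near_def not_less)
  qed
  have c_le: "?c \<sigma> \<le> 2 * hamming x y" if "\<sigma> \<in> A" for \<sigma>
    using hamming_triangle[of \<sigma> x y] hamming_triangle[of \<sigma> y x] fin[OF that] assms(3,4)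
    unfolding card_between_thresholds by (auto simp: hamming_commute[of y x])
  from near_unique[OF assms(3)] near_unique[OF assms(4)]
  consider "near x = {}" "near y = {}"
    | \<sigma> where "\<sigma> \<in> A" "near x \<union> near y = {\<sigma>}"
    | \<sigma> \<tau> where "near x = {\<sigma>}" "near y = {\<tau>}" "\<sigma> \<noteq> \<tau>"
    using near_sub[of x] near_sub[of y] by (elim disjE exE) fastforce+
  then show ?thesis
  proof cases
    case 1
    then show ?thesis unfolding sum_eq by simp
  next
    case 2
    then show ?thesis using c_le unfolding sum_eq by simp
  next
    case (3 \<sigma> \<tau>)
    have *: "\<sigma> \<in> A" "\<tau> \<in> A" "2 * hamming \<sigma> x < D" "2 * hamming \<tau> y < D"
      "D \<le> 2 * hamming \<sigma> y" "D \<le> 2 * hamming \<tau> x"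
      using 3 by (auto simp: near_def set_eq_iff not_less)
    have "hamming \<sigma> \<tau> \<le> hamming \<sigma> x + (hamming x y + hamming \<tau> y)"
      using hamming_triangle[of \<sigma> x \<tau>] hamming_triangle[of x y \<tau>] fin * assms(3,4)
      by (auto simp: hamming_commute[of y \<tau>])
    moreover have "D \<le> hamming \<sigma> \<tau>" using sep * 3 by auto
    moreover have "?c \<sigma> = D - 2 * hamming \<sigma> x" "?c \<tau> = D - 2 * hamming \<tau> y"
      unfolding card_between_thresholds using * by auto
    ultimately show ?thesis using 3 * unfolding sum_eq by simp
  qed
qed

lemma sum_cut_val:
  assumes "finite E" "finite C"
  shows "(\<Sum>S\<in>C. cut_val q E (B S)) = (\<Sum>e\<in>E. q e * real (card {S \<in> C. crosses (B S) e}))"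
proof -
  have "(\<Sum>S\<in>C. cut_val q E (B S)) = (\<Sum>S\<in>C. \<Sum>e\<in>E. if crosses (B S) e then q e else 0)"
    unfolding cut_val_def using assms by (intro sum.cong refl sum.inter_filter)
  also have "\<dots> = (\<Sum>e\<in>E. \<Sum>S\<in>C. if crosses (B S) e then q e else 0)"
    by (rule sum.swap)
  also have "\<dots> = (\<Sum>e\<in>E. q e * real (card {S \<in> C. crosses (B S) e}))"
    using assms by (intro sum.cong refl) (simp add: sum.inter_filter[symmetric])
  finally show ?thesis .
qed

text \<open>Double counting of the boundaries of the \<open>card A * D\<close> balls around the
  classes. Each ball contains one end but not the other of a crossed edge of \<open>R\<close>, so it
  weighs at least \<open>k\<close>; each edge of \<open>E\<close> lies on at most twice as many
  boundaries as there are cuts of \<open>C\<close> crossing it.\<close>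

lemma cut_family_spread:
  fixes q :: "'a set \<Rightarrow> real"
  assumes "finite V" "finite E" "finite C"
    and E: "\<And>e. e \<in> E \<Longrightarrow> e \<subseteq> V \<and> card e = 2"
    and R: "\<And>e. e \<in> R \<Longrightarrow> e \<subseteq> V \<and> card e = 2"
    and q: "\<And>e. e \<in> E \<Longrightarrow> 0 \<le> q e"
    and heavy: "\<And>e S. e \<in> R \<Longrightarrow> S \<subseteq> V \<Longrightarrow> crosses S e \<Longrightarrow> k \<le> cut_val q E S"
    and A: "A = signature C ` active R C"
    and sep: "\<And>\<sigma> \<tau>. \<sigma> \<in> A \<Longrightarrow> \<tau> \<in> A \<Longrightarrow> \<sigma> \<noteq> \<tau> \<Longrightarrow> D \<le> hamming \<sigma> \<tau>"
  shows "real (card A * D) * k \<le> 2 * (\<Sum>S\<in>C. cut_val q E S)"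
proof -
  have act: "active R C \<subseteq> V" using R unfolding active_def by auto
  have finA: "finite A" unfolding A using act assms(1) finite_subset by blast
  have fins: "finite (signature C u)" for u unfolding signature_def using assms(3) by auto
  define ball where "ball = (\<lambda>(\<sigma>, r). {v \<in> V. 2 * hamming \<sigma> (signature C v) \<le> r})"
  have ball_ge: "k \<le> cut_val q E (ball (\<sigma>, r))" if "\<sigma> \<in> A" "r < D" for \<sigma> r
  proof -
    obtain u e S where ue: "\<sigma> = signature C u" "u \<in> e" "e \<in> R" "S \<in> C" "crosses S e"
      using \<open>\<sigma> \<in> A\<close> unfolding A active_def by auto
    obtain v where e: "e = {u, v}"
      using R[OF ue(3)] ue(2) by (auto simp: card_2_iff)
    have "v \<in> active R C" using ue e unfolding active_def by auto
    then have vA: "signature C v \<in> A" unfolding A by auto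
    have "S \<in> signature C u \<longleftrightarrow> S \<notin> signature C v"
      using ue unfolding e crosses_doubleton separates_def signature_def by auto
    then have "D \<le> hamming \<sigma> (signature C v)"
      using sep[OF that(1) vA] ue(1) by auto
    then have "v \<notin> ball (\<sigma>, r)" using that by (auto simp: ball_def)
    moreover have "u \<in> ball (\<sigma>, r)"
      using R[OF ue(3)] ue(2) fins by (auto simp: ball_def ue(1) hamming_def)
    ultimately have "crosses (ball (\<sigma>, r)) e" unfolding e crosses_doubleton separates_def by simp
    then show ?thesis using heavy[OF ue(3)] by (auto simp: ball_def)
  qed
  have "real (card A * D) * k = (\<Sum>x\<in>A \<times> {..<D}. k)"
    by (simp add: card_cartesian_product)
  also have "\<dots> \<le> (\<Sum>x\<in>A \<times> {..<D}. cut_val q E (ball x))"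
    by (rule sum_mono) (use ball_ge in auto)
  also have "\<dots> = (\<Sum>e\<in>E. q e * real (card {x \<in> A \<times> {..<D}. crosses (ball x) e}))"
    by (rule sum_cut_val) (use assms finA in auto)
  also have "\<dots> \<le> (\<Sum>e\<in>E. q e * real (2 * card {S \<in> C. crosses S e}))"
  proof (intro sum_mono mult_left_mono q of_nat_mono)
    fix e assume e: "e \<in> E"
    then obtain u v where uv: "e = {u, v}" "u \<in> V" "v \<in> V" using E[of e] by (auto simp: card_2_iff)
    have "{x \<in> A \<times> {..<D}. crosses (ball x) e} = (SIGMA \<sigma>:A. {r \<in> {..<D}.
        (2 * hamming \<sigma> (signature C u) \<le> r) \<noteq> (2 * hamming \<sigma> (signature C v) \<le> r)})"
      using uv unfolding uv(1) crosses_doubleton separates_def ball_def by auto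
    then have "card {x \<in> A \<times> {..<D}. crosses (ball x) e} = (\<Sum>\<sigma>\<in>A. card {r \<in> {..<D}.
        (2 * hamming \<sigma> (signature C u) \<le> r) \<noteq> (2 * hamming \<sigma> (signature C v) \<le> r)})"
      using finA by (simp add: card_SigmaI)
    also have "\<dots> \<le> 2 * hamming (signature C u) (signature C v)"
      by (rule disjoint_balls_overlap[OF finA]) (use fins sep A in auto)
    finally show "card {x \<in> A \<times> {..<D}. crosses (ball x) e} \<le> 2 * card {S \<in> C. crosses S e}"
      unfolding hamming_signature uv(1) crosses_doubleton .
  qed
  also have "\<dots> = 2 * (\<Sum>S\<in>C. cut_val q E S)"
    using sum_cut_val[OF assms(2,3), of q "\<lambda>S. S"] by (simp add: sum_distrib_left mult_ac)
  finally show ?thesis .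
qed

text \<open>Induction on the number \<open>a\<close> of classes, with \<open>b\<close> in the role
  of 2 \<alpha>. While \<open>a > b\<close>, discarding the cuts that separate a closest pair of
  classes lowers \<open>a\<close> and keeps at least a fraction \<open>1 - b / a\<close> of the
  family; the inverse fractions multiply up to a binomial coefficient. \<open>max\<close> turns that
  coefficient into 1 in the base case \<open>a <= b\<close>.\<close>

lemma card_cut_family_le:
  fixes q :: "'a set \<Rightarrow> real"
  assumes "finite V" "finite E" "finite C"
    and E: "\<And>e. e \<in> E \<Longrightarrow> e \<subseteq> V \<and> card e = 2"
    and R: "\<And>e. e \<in> R \<Longrightarrow> e \<subseteq> V \<and> card e = 2"
    and q: "\<And>e. e \<in> E \<Longrightarrow> 0 \<le> q e"
    and heavy: "\<And>e S. e \<in> R \<Longrightarrow> S \<subseteq> V \<Longrightarrow> crosses S e \<Longrightarrow> k \<le> cut_val q E S"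
    and "0 < k"
    and inj: "inj_on (\<lambda>S. {e \<in> R. crosses S e}) C"
    and light: "\<And>S. S \<in> C \<Longrightarrow> 2 * cut_val q E S \<le> real b * k"
  shows "card C \<le> 2 ^ b * (max (card (signature C ` active R C)) b choose b)"
  using assms(3) inj light
proof (induction "card (signature C ` active R C)" arbitrary: C rule: less_induct)
  case less
  define A where "A = signature C ` active R C"
  define a where "a = card A"
  have act: "active R C \<subseteq> V" using R unfolding active_def by auto
  have finA: "finite A" unfolding A_def using act assms(1) finite_subset by blast
  have fins: "finite (signature C u)" for u unfolding signature_def using less.prems(1) by auto
  show ?case
  proof (cases "a \<le> b")
    case True
    \<comment> \<open>The classes contained in a cut determine its projection: an edge of
      \<open>R\<close> crossed by some cut of \<open>C\<close> has both ends in
      \<open>active R C\<close>, and any other edge of \<open>R\<close> is crossed by no cut of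
      \<open>C\<close>.\<close>
    have "inj_on (\<lambda>S. {\<sigma> \<in> A. S \<in> \<sigma>}) C"
    proof (rule inj_onI)
      fix S S' assume S: "S \<in> C" "S' \<in> C" and eq: "{\<sigma> \<in> A. S \<in> \<sigma>} = {\<sigma> \<in> A. S' \<in> \<sigma>}"
      have "crosses S e \<longleftrightarrow> crosses S' e" if "e \<in> R" for e
      proof (cases "\<exists>T\<in>C. crosses T e")
        case True
        then have "e \<subseteq> active R C" using that unfolding active_def by auto
        moreover have "w \<in> S \<longleftrightarrow> w \<in> S'" if "w \<in> active R C" for w
        proof -
          have "signature C w \<in> A" using that by (auto simp: A_def)
          then have "S \<in> signature C w \<longleftrightarrow> S' \<in> signature C w" using eq by auto
          then show ?thesis using S by (simp add: signature_def)
        qed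
        ultimately show ?thesis unfolding crosses_def by blast
      qed (use S in blast)
      then have "{e \<in> R. crosses S e} = {e \<in> R. crosses S' e}" by blast
      then show "S = S'" using inj_onD[OF less.prems(2) _ S] by blast
    qed
    then have "card C \<le> card (Pow A)"
      by (rule card_inj_on_le) (use finA in auto)
    also have "\<dots> \<le> 2 ^ b" using True finA by (simp add: card_Pow a_def)
    finally show ?thesis using True by (simp add: a_def A_def max_def)
  next
    case False
    define pairs where "pairs = {(\<sigma>, \<tau>). \<sigma> \<in> A \<and> \<tau> \<in> A \<and> \<sigma> \<noteq> \<tau>}"
    have "pairs \<subseteq> A \<times> A" by (auto simp: pairs_def)
    then have finp: "finite pairs" using finA finite_subset by blast
    have "pairs \<noteq> {}"
    proof -
      obtain \<sigma> where "\<sigma> \<in> A" using False by (cases "A = {}") (auto simp: a_def)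
      then obtain u e S where ue: "\<sigma> = signature C u" "u \<in> e" "e \<in> R" "S \<in> C" "crosses S e"
        unfolding A_def active_def by auto
      obtain v where e: "e = {u, v}"
        using R[OF ue(3)] ue(2) by (auto simp: card_2_iff)
      have "v \<in> active R C" using ue e unfolding active_def by auto
      then have vA: "signature C v \<in> A" unfolding A_def by auto
      have "S \<in> signature C u \<longleftrightarrow> S \<notin> signature C v"
        using ue unfolding e crosses_doubleton separates_def signature_def by auto
      then have "(\<sigma>, signature C v) \<in> pairs" using vA ue \<open>\<sigma> \<in> A\<close> by (auto simp: pairs_def)
      then show ?thesis by auto
    qed
    then obtain \<sigma> \<tau> where st: "(\<sigma>, \<tau>) \<in> pairs"
      and min: "\<And>x. x \<in> pairs \<Longrightarrow> case_prod hamming (\<sigma>, \<tau>) \<le> case_prod hamming x"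
      using finp arg_min_if_finite[of pairs "case_prod hamming"] 
      by (metis linorder_not_less surj_pair)
    define D where "D = hamming \<sigma> \<tau>"
    from st obtain u v where uv: "u \<in> active R C" "v \<in> active R C" "\<sigma> = signature C u" "\<tau> = signature C v"
      and "\<sigma> \<noteq> \<tau>" by (auto simp: pairs_def A_def)
    have "real (card A * D) * k \<le> 2 * (\<Sum>S\<in>C. cut_val q E S)"
    proof (rule cut_family_spread[OF assms(1,2) less.prems(1) E R q heavy A_def])
      show "D \<le> hamming \<sigma>' \<tau>'" if "\<sigma>' \<in> A" "\<tau>' \<in> A" "\<sigma>' \<noteq> \<tau>'" for \<sigma>' \<tau>'
        using min[of "(\<sigma>', \<tau>')"] that by (auto simp: D_def pairs_def)
    qed
    also have "\<dots> \<le> (\<Sum>S\<in>C. real b * k)"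
      unfolding sum_distrib_left by (rule sum_mono) (use less.prems in auto)
    finally have "real (a * D) * k \<le> real (b * card C) * k"
      by (simp add: a_def mult_ac)
    then have "real (a * D) \<le> real (b * card C)" using \<open>0 < k\<close> by (simp only: mult_le_cancel_right_pos)
    then have aD: "a * D \<le> b * card C" by (simp only: of_nat_le_iff)
    define C' where "C' = {S \<in> C. \<not> separates S u v}"
    have "C' \<subseteq> C" by (auto simp: C'_def)
    have finC': "finite C'" using less.prems(1) by (auto simp: C'_def)
    have "D = card {S \<in> C. separates S u v}" unfolding D_def uv hamming_signature ..
    moreover have "C = C' \<union> {S \<in> C. separates S u v}" "C' \<inter> {S \<in> C. separates S u v} = {}"
      by (auto simp: C'_def)
    ultimately have cC: "card C = card C' + D"
      using card_Un_disjoint[of C' "{S \<in> C. separates S u v}"] less.prems(1) finC' by simp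
    have sig': "signature C' w = signature C w \<inter> C'" for w
      unfolding signature_def C'_def by auto
    have "active R C' \<subseteq> active R C" unfolding active_def C'_def by auto
    then have sub: "signature C' ` active R C' \<subseteq> (\<lambda>\<rho>. \<rho> \<inter> C') ` A"
      unfolding A_def sig' by auto
    \<comment> \<open>With the cuts separating \<open>u\<close> and \<open>v\<close> gone, their two
      signatures coincide, so at least one class is lost.\<close>
    have "card ((\<lambda>\<rho>. \<rho> \<inter> C') ` A) < card A"
    proof -
      have "\<sigma> \<inter> C' = \<tau> \<inter> C'" unfolding uv signature_def C'_def separates_def by auto
      then have "\<not> inj_on (\<lambda>\<rho>. \<rho> \<inter> C') A" using st unfolding inj_on_def pairs_def by blast
      then show ?thesis using finA card_image_le eq_card_imp_inj_on le_neq_implies_less by blast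
    qed
    moreover have "card (signature C' ` active R C') \<le> card ((\<lambda>\<rho>. \<rho> \<inter> C') ` A)"
      by (rule card_mono) (use sub finA in auto)
    ultimately have lt: "card (signature C' ` active R C') < a" by (simp add: a_def)
    have "card C' \<le> 2 ^ b * (max (card (signature C' ` active R C')) b choose b)"
      by (rule less.hyps) (use lt \<open>C' \<subseteq> C\<close> finC' less.prems in \<open>auto simp: a_def A_def intro: inj_on_subset\<close>)
    also have "\<dots> \<le> 2 ^ b * ((a - 1) choose b)"
      by (intro mult_left_mono binomial_right_mono) (use lt False in auto)
    finally have C'_le: "card C' \<le> 2 ^ b * ((a - 1) choose b)" .
    have "a * card C \<le> a * card C' + b * card C" using aD by (simp add: cC algebra_simps)
    then have "(a - b) * card C \<le> a * card C'" by (simp add: diff_mult_distrib)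
    also have "\<dots> \<le> 2 ^ b * (a * ((a - 1) choose b))"
      using C'_le mult_left_mono[OF C'_le, of a] by (simp add: mult_ac)
    \<comment> \<open>Absorption: \<open>a / (a - b)\<close> is the ratio of
      \<open>a choose b\<close> to \<open>(a - 1) choose b\<close>.\<close>
    also have "a * ((a - 1) choose b) = (a - b) * (a choose b)"
      using binomial_absorb_comp[of a b] by simp
    finally have "(a - b) * card C \<le> (a - b) * (2 ^ b * (a choose b))" by (simp add: mult_ac)
    then have "card C \<le> 2 ^ b * (a choose b)" using False by simp
    then show ?thesis using False by (simp add: a_def A_def max_def)
  qed
qed

text \<open>Lets the factor \<open>2 ^ b\<close> of the counting bound be absorbed into
  \<open>fact b\<close>, leaving \<open>card V ^ b\<close>. The inequality fails for
  \<open>b = 3\<close>, whence the start at 4.\<close>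

lemma two_pow_le_fact: "4 \<le> b \<Longrightarrow> (2::nat) ^ b \<le> fact b"
proof (induction b rule: dec_induct)
  case base
  show ?case by (simp add: fact_numeral)
next
  case (step b)
  have "(2::nat) ^ Suc b \<le> Suc b * 2 ^ b" using step by simp
  also have "\<dots> \<le> Suc b * fact b" using step by (intro mult_left_mono) auto
  finally show ?case by simp
qed

lemma card_cut_family_le_power:
  fixes q :: "'a set \<Rightarrow> real"
  assumes "finite V" "finite E" "finite C"
    and E: "\<And>e. e \<in> E \<Longrightarrow> e \<subseteq> V \<and> card e = 2"
    and R: "\<And>e. e \<in> R \<Longrightarrow> e \<subseteq> V \<and> card e = 2"
    and q: "\<And>e. e \<in> E \<Longrightarrow> 0 \<le> q e"
    and heavy: "\<And>e S. e \<in> R \<Longrightarrow> S \<subseteq> V \<Longrightarrow> crosses S e \<Longrightarrow> k \<le> cut_val q E S"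
    and "0 < k"
    and inj: "inj_on (\<lambda>S. {e \<in> R. crosses S e}) C"
    and light: "\<And>S. S \<in> C \<Longrightarrow> 2 * cut_val q E S \<le> real b * k"
    and "4 \<le> b" and "2 \<le> card V"
  shows "card C \<le> card V ^ b"
proof -
  let ?n = "card V"
  have act: "active R C \<subseteq> V" using R unfolding active_def by auto
  have "card (signature C ` active R C) \<le> card (active R C)"
    by (rule card_image_le) (use act assms(1) finite_subset in blast)
  also have "\<dots> \<le> ?n" using act assms(1) by (rule card_mono[rotated])
  finally have le: "card (signature C ` active R C) \<le> ?n" .
  have "card C \<le> 2 ^ b * (max (card (signature C ` active R C)) b choose b)"
    by (rule card_cut_family_le[OF assms(1-10)])
  also have "\<dots> \<le> 2 ^ b * (max ?n b choose b)"
    by (intro mult_left_mono binomial_right_mono) (use le in auto)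
  also have "\<dots> \<le> ?n ^ b"
  proof (cases "?n \<le> b")
    case True
    then show ?thesis using assms(12) by (simp add: max_def power_mono)
  next
    case False
    have "2 ^ b * (?n choose b) \<le> fact b * (?n choose b)"
      by (intro mult_right_mono two_pow_le_fact assms) auto
    also have "\<dots> \<le> ?n ^ b" using binomial_fact_pow[of ?n b] by (simp add: mult_ac)
    finally show ?thesis using False by (simp add: max_def)
  qed
  finally show ?thesis .
qed


section \<open>Concentration over all cuts\<close>

lemma exp_le_quadratic:
  fixes x :: real
  assumes "\<bar>x\<bar> \<le> 1"
  shows "exp x \<le> 1 + x + x\<^sup>2"
proof (cases "0 \<le> x")
  case True
  then show ?thesis using exp_bound[of x] assms by auto
next
  case False
  have "exp x * (1 - x) \<le> exp x * exp (- x)"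
    by (intro mult_left_mono) (use exp_ge_add_one_self[of "- x"] in auto)
  also have "\<dots> = 1" by (simp add: exp_minus)
  \<comment> \<open>The right-hand side is \<open>1 - x ^ 3\<close>.\<close>
  also have "1 \<le> (1 + x + x\<^sup>2) * (1 - x)"
  proof -
    have "x ^ 3 \<le> 0" using False by (simp add: power_le_zero_eq)
    then show ?thesis by (simp add: algebra_simps power2_eq_square power3_eq_cube)
  qed
  finally show ?thesis using False by (simp add: mult_le_cancel_right)
qed

text \<open>Exponential moments at \<theta> of absolute value \<delta> / 2, the minimiser of
  \<open>M * t^2 - t * \<delta> * M\<close>, where the value is \<open>- \<delta>^2 * M / 4\<close>.
  As \<open>M\<close> may be any upper bound of \<open>v * card D\<close>, deviations can be
  measured against a heavier cut than the sampled one.\<close>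

lemma Pi_pmf_chernoff_one_sided:
  fixes f :: "'b \<Rightarrow> real"
  assumes "finite R" "D \<subseteq> R" and fin: "finite (set_pmf p)"
    and mgf: "\<And>\<theta>. \<bar>\<theta>\<bar> \<le> 1 \<Longrightarrow> measure_pmf.expectation p (\<lambda>x. exp (\<theta> * f x)) \<le> exp (v * \<theta>\<^sup>2)"
    and M: "v * real (card D) \<le> M" and \<delta>: "0 < \<delta>" "\<delta> \<le> 1"
  shows "measure_pmf.prob (Pi_pmf R d (\<lambda>_. p)) {\<omega>. (\<Sum>e\<in>D. f (\<omega> e)) > \<delta> * M} \<le> exp (- (\<delta>\<^sup>2 * M / 4))"
    and "measure_pmf.prob (Pi_pmf R d (\<lambda>_. p)) {\<omega>. (\<Sum>e\<in>D. f (\<omega> e)) < - (\<delta> * M)} \<le> exp (- (\<delta>\<^sup>2 * M / 4))"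
proof -
  let ?P = "Pi_pmf R d (\<lambda>_. p)"
  have finD: "finite D" using assms finite_subset by blast
  have int: "integrable (measure_pmf p) g" for g :: "'b \<Rightarrow> real"
    using fin by (rule integrable_measure_pmf_finite)
  have bound: "measure_pmf.prob ?P {\<omega>. \<theta> * (\<Sum>e\<in>D. f (\<omega> e)) \<ge> \<delta> / 2 * (\<delta> * M)} \<le> exp (- (\<delta>\<^sup>2 * M / 4))"
    if \<theta>: "\<bar>\<theta>\<bar> = \<delta> / 2" for \<theta>
  proof -
    \<comment> \<open>The constant 1 outside \<open>D\<close> turns the exponential of the sum into
      a product over all of \<open>R\<close>, to which independence applies.\<close>
    define g where "g e x = (if e \<in> D then exp (\<theta> * f x) else 1)" for e x
    have prod_g: "(\<Prod>e\<in>R. g e (\<omega> e)) = exp (\<theta> * (\<Sum>e\<in>D. f (\<omega> e)))" for \<omega>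
    proof -
      have "(\<Prod>e\<in>R. g e (\<omega> e)) = (\<Prod>e\<in>D. g e (\<omega> e))"
        using assms by (intro prod.mono_neutral_right) (auto simp: g_def)
      also have "\<dots> = exp (\<theta> * (\<Sum>e\<in>D. f (\<omega> e)))"
        using finD by (simp add: g_def exp_sum sum_distrib_left)
      finally show ?thesis .
    qed
    have "measure_pmf.expectation ?P (\<lambda>\<omega>. exp (\<theta> * (\<Sum>e\<in>D. f (\<omega> e)))) =
        (\<Prod>e\<in>R. measure_pmf.expectation p (g e))"
      unfolding prod_g[symmetric]
      by (rule expectation_prod_Pi_pmf) (use assms int in \<open>auto simp: g_def\<close>)
    also have "\<dots> = (\<Prod>e\<in>D. measure_pmf.expectation p (g e))"
    proof (rule prod.mono_neutral_right)
      have "g e = (\<lambda>_. 1)" if "e \<notin> D" for e using that by (simp add: g_def fun_eq_iff)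
      then show "\<forall>e\<in>R - D. measure_pmf.expectation p (g e) = 1" by simp
    qed (use assms in auto)
    also have "\<dots> \<le> (\<Prod>e\<in>D. exp (v * \<theta>\<^sup>2))"
    proof (intro prod_mono conjI)
      fix e assume "e \<in> D"
      then have "g e = (\<lambda>x. exp (\<theta> * f x))" by (simp add: g_def fun_eq_iff)
      then show "measure_pmf.expectation p (g e) \<le> exp (v * \<theta>\<^sup>2)"
        using mgf[of \<theta>] \<theta> \<delta> by simp
      show "0 \<le> measure_pmf.expectation p (g e)"
        by (intro Bochner_Integration.integral_nonneg_AE AE_pmfI) (simp add: g_def)
    qed
    also have "\<dots> = exp ((v * real (card D)) * \<theta>\<^sup>2)"
      by (simp add: exp_of_nat_mult[symmetric] mult_ac)
    also have "\<dots> \<le> exp (M * \<theta>\<^sup>2)"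
      using M by (simp add: mult_right_mono)
    finally have E: "measure_pmf.expectation ?P (\<lambda>\<omega>. exp (\<theta> * (\<Sum>e\<in>D. f (\<omega> e)))) \<le> exp (M * \<theta>\<^sup>2)" .
    have "measure_pmf.prob ?P {\<omega>. \<theta> * (\<Sum>e\<in>D. f (\<omega> e)) \<ge> \<delta> / 2 * (\<delta> * M)} =
        measure_pmf.prob ?P {\<omega> \<in> space ?P. exp (\<theta> * (\<Sum>e\<in>D. f (\<omega> e))) \<ge> exp (\<delta> / 2 * (\<delta> * M))}"
      by simp
    also have "\<dots> \<le> measure_pmf.expectation ?P (\<lambda>\<omega>. exp (\<theta> * (\<Sum>e\<in>D. f (\<omega> e)))) / exp (\<delta> / 2 * (\<delta> * M))"
    proof (rule integral_Markov_inequality_measure[where A = "{}"])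
      show "integrable ?P (\<lambda>\<omega>. exp (\<theta> * (\<Sum>e\<in>D. f (\<omega> e))))"
        unfolding prod_g[symmetric] by (rule integrable_prod_Pi_pmf) (use assms int in auto)
    qed auto
    also have "\<dots> \<le> exp (M * \<theta>\<^sup>2) / exp (\<delta> / 2 * (\<delta> * M))"
      by (intro divide_right_mono E) auto
    also have "\<dots> = exp (M * \<bar>\<theta>\<bar>\<^sup>2 - \<delta> / 2 * (\<delta> * M))"
      by (simp add: exp_diff)
    also have "M * \<bar>\<theta>\<bar>\<^sup>2 - \<delta> / 2 * (\<delta> * M) = - (\<delta>\<^sup>2 * M / 4)"
      unfolding \<theta> by (simp add: power2_eq_square field_simps)
    finally show ?thesis .
  qed
  show "measure_pmf.prob ?P {\<omega>. (\<Sum>e\<in>D. f (\<omega> e)) > \<delta> * M} \<le> exp (- (\<delta>\<^sup>2 * M / 4))"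
    using \<delta> by (intro order.trans[OF measure_pmf.finite_measure_mono bound[of "\<delta> / 2"]]) auto
  show "measure_pmf.prob ?P {\<omega>. (\<Sum>e\<in>D. f (\<omega> e)) < - (\<delta> * M)} \<le> exp (- (\<delta>\<^sup>2 * M / 4))"
  proof (rule order.trans[OF measure_pmf.finite_measure_mono bound[of "- \<delta> / 2"]])
    show "{\<omega>. (\<Sum>e\<in>D. f (\<omega> e)) < - (\<delta> * M)} \<subseteq> {\<omega>. \<delta> / 2 * (\<delta> * M) \<le> - \<delta> / 2 * (\<Sum>e\<in>D. f (\<omega> e))}"
    proof safe
      fix \<omega> assume "(\<Sum>e\<in>D. f (\<omega> e)) < - (\<delta> * M)"
      then have "\<delta> / 2 * (\<delta> * M) \<le> \<delta> / 2 * - (\<Sum>e\<in>D. f (\<omega> e))"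
        using \<delta> by (intro mult_left_mono) auto
      then show "\<delta> / 2 * (\<delta> * M) \<le> - \<delta> / 2 * (\<Sum>e\<in>D. f (\<omega> e))" by simp
    qed
  qed (use \<delta> in auto)
qed

lemma Pi_pmf_chernoff:
  fixes f :: "'b \<Rightarrow> real"
  assumes "finite R" "D \<subseteq> R" "finite (set_pmf p)"
    and "\<And>\<theta>. \<bar>\<theta>\<bar> \<le> 1 \<Longrightarrow> measure_pmf.expectation p (\<lambda>x. exp (\<theta> * f x)) \<le> exp (v * \<theta>\<^sup>2)"
    and "v * real (card D) \<le> M" "0 < \<delta>" "\<delta> \<le> 1"
  shows "measure_pmf.prob (Pi_pmf R d (\<lambda>_. p)) {\<omega>. \<bar>\<Sum>e\<in>D. f (\<omega> e)\<bar> > \<delta> * M} \<le> 2 * exp (- (\<delta>\<^sup>2 * M / 4))"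
proof -
  let ?P = "Pi_pmf R d (\<lambda>_. p)"
  have "measure_pmf.prob ?P {\<omega>. \<bar>\<Sum>e\<in>D. f (\<omega> e)\<bar> > \<delta> * M} \<le>
      measure_pmf.prob ?P ({\<omega>. (\<Sum>e\<in>D. f (\<omega> e)) > \<delta> * M} \<union> {\<omega>. (\<Sum>e\<in>D. f (\<omega> e)) < - (\<delta> * M)})"
    by (rule measure_pmf.finite_measure_mono) auto
  also have "\<dots> \<le> measure_pmf.prob ?P {\<omega>. (\<Sum>e\<in>D. f (\<omega> e)) > \<delta> * M} +
      measure_pmf.prob ?P {\<omega>. (\<Sum>e\<in>D. f (\<omega> e)) < - (\<delta> * M)}"
    by (rule measure_subadditive) auto
  also have "\<dots> \<le> exp (- (\<delta>\<^sup>2 * M / 4)) + exp (- (\<delta>\<^sup>2 * M / 4))"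
    by (intro add_mono Pi_pmf_chernoff_one_sided[OF assms])
  finally show ?thesis by simp
qed

lemma bernoulli_half_mgf:
  fixes \<theta> :: real
  assumes "\<bar>\<theta>\<bar> \<le> 1"
  shows "measure_pmf.expectation (bernoulli_pmf (1/2)) (\<lambda>b. exp (\<theta> * (if b then 1 else -1))) \<le> exp (1 * \<theta>\<^sup>2)"
proof -
  have "measure_pmf.expectation (bernoulli_pmf (1/2)) (\<lambda>b. exp (\<theta> * (if b then 1 else -1))) =
      (exp \<theta> + exp (- \<theta>)) / 2"
    by simp
  also have "\<dots> \<le> 1 + \<theta>\<^sup>2"
    using exp_le_quadratic[of \<theta>] exp_le_quadratic[of "- \<theta>"] assms by simp
  also have "\<dots> \<le> exp (1 * \<theta>\<^sup>2)" by simp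
  finally show ?thesis .
qed

text \<open>A single trial has moment \<open>1 + p * (exp \<theta> - 1)\<close>, at most
  \<open>exp (p * (exp \<theta> - 1))\<close>. After centring, the exponent is
  \<open>N * p * (exp \<theta> - 1 - \<theta>)\<close>, which the quadratic bound controls.\<close>

lemma binomial_mgf:
  fixes \<theta> :: real
  assumes p: "0 \<le> p" "p \<le> 1" and \<theta>: "\<bar>\<theta>\<bar> \<le> 1"
  shows "measure_pmf.expectation (binomial_pmf N p) (\<lambda>r. exp (\<theta> * (real r - real N * p))) \<le>
    exp (real N * p * \<theta>\<^sup>2)"
proof -
  have "measure_pmf.expectation (binomial_pmf N p) (\<lambda>r. exp (\<theta> * (real r - real N * p))) =
      (\<Sum>r\<le>N. real (N choose r) * p ^ r * (1 - p) ^ (N - r) * (exp (real r * \<theta>) * exp (- (real N * p * \<theta>))))"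
    using p by (subst expectation_binomial_pmf')
      (auto intro!: sum.cong simp: exp_add[symmetric] algebra_simps)
  also have "\<dots> = (p * exp \<theta> + (1 - p)) ^ N * exp (- (real N * p * \<theta>))"
    unfolding binomial_ring sum_distrib_right
    by (intro sum.cong) (simp_all add: power_mult_distrib exp_of_nat_mult mult_ac flip: exp_of_nat2_mult)
  also have "\<dots> \<le> exp (p * (exp \<theta> - 1)) ^ N * exp (- (real N * p * \<theta>))"
  proof (intro mult_right_mono power_mono)
    show "p * exp \<theta> + (1 - p) \<le> exp (p * (exp \<theta> - 1))"
      using exp_ge_add_one_self[of "p * (exp \<theta> - 1)"] by (simp add: algebra_simps)
    show "0 \<le> p * exp \<theta> + (1 - p)" using p by simp
  qed simp
  also have "\<dots> = exp (real N * p * (exp \<theta> - 1 - \<theta>))"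
    by (simp add: exp_of_nat_mult[symmetric] exp_add[symmetric] algebra_simps)
  also have "\<dots> \<le> exp (real N * p * \<theta>\<^sup>2)"
    using exp_le_quadratic[OF \<theta>] p by (simp add: mult_left_mono)
  finally show ?thesis .
qed

section \<open>Union bound over cut projections\<close>

lemma geometric_tail_le:
  fixes n :: real
  assumes "2 \<le> n"
  shows "(\<Sum>j\<in>{1..J}. n ^ (2 * (j + 1)) * (2 * (1 / n) ^ (6 * j))) \<le> 4 / n\<^sup>2"
proof -
  have n: "0 < n" using assms by simp
  have x: "0 \<le> 1 / n ^ 4" "1 / n ^ 4 \<le> 1 / 2"
  proof -
    have "2 ^ 4 \<le> n ^ 4" by (rule power_mono) (use assms in auto)
    then show "1 / n ^ 4 \<le> 1 / 2" using n by (simp add: field_simps)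
  qed (use n in simp)
  \<comment> \<open>Number of projections at level \<open>j\<close> times the failure bound for
    each: \<open>2 * n^2 * n^(-4 j)\<close>.\<close>
  have "(\<Sum>j\<in>{1..J}. n ^ (2 * (j + 1)) * (2 * (1 / n) ^ (6 * j))) = (\<Sum>j\<in>{1..J}. 2 * n\<^sup>2 * (1 / n ^ 4) ^ j)"
  proof (intro sum.cong refl)
    fix j :: nat
    have "n ^ (6 * j) = n ^ (4 * j) * n ^ (2 * j)" by (simp add: power_add[symmetric])
    then show "n ^ (2 * (j + 1)) * (2 * (1 / n) ^ (6 * j)) = 2 * n\<^sup>2 * (1 / n ^ 4) ^ j"
      using n by (simp add: power_add power_divide power_mult[symmetric] power2_eq_square field_simps)
  qed
  also have "\<dots> = (\<Sum>j<J. (2 / n\<^sup>2) * (1 / n ^ 4) ^ j)"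
  proof (rule sum.reindex_bij_witness[of _ Suc "\<lambda>j. j - 1"])
    fix j assume "j \<in> {1..J}"
    then show "(2 / n\<^sup>2) * (1 / n ^ 4) ^ (j - 1) = 2 * n\<^sup>2 * (1 / n ^ 4) ^ j"
      using n by (cases j) (auto simp: field_simps power2_eq_square eval_nat_numeral)
  qed auto
  also have "\<dots> \<le> (2 / n\<^sup>2) * (\<Sum>j<J. (1 / 2) ^ j)"
    unfolding sum_distrib_left[symmetric]
    by (intro mult_left_mono sum_mono power_mono x) (use n in auto)
  also have "\<dots> \<le> (2 / n\<^sup>2) * 2"
    by (intro mult_left_mono) (use n in \<open>auto simp: sum_gp_strict\<close>)
  finally show ?thesis by simp
qed

text \<open>Serves both halving and resampling. The deviation depends on a cut only through its
  projection to \<open>R\<close>, so testing one lightest cut per projection suffices. Grouped by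
  weight in units of \<open>k\<close>, there are at most \<open>n^(2 (j + 1))\<close> of them at
  level \<open>j\<close>, and the condition on \<kappa> makes each fail with probability at most
  \<open>2 * n^(-6 j)\<close>.\<close>

lemma cut_union_bound:
  fixes q :: "'a set \<Rightarrow> real" and M :: "'w pmf" and dev :: "'w \<Rightarrow> 'a set set \<Rightarrow> real"
  assumes "finite V" "finite E" 
    and E: "\<And>e. e \<in> E \<Longrightarrow> e \<subseteq> V \<and> card e = 2"
    and R: "\<And>e. e \<in> R \<Longrightarrow> e \<subseteq> V \<and> card e = 2"
    and q: "\<And>e. e \<in> E \<Longrightarrow> 0 \<le> q e"
    and heavy: "\<And>e S. e \<in> R \<Longrightarrow> S \<subseteq> V \<Longrightarrow> crosses S e \<Longrightarrow> k \<le> cut_val q E S"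
    and "0 < k" and n: "2 \<le> card V" and "0 \<le> \<delta>"
    and dev0: "\<And>\<omega>. dev \<omega> {} = 0"
    and tail: "\<And>S. S \<subseteq> V \<Longrightarrow> measure_pmf.prob M {\<omega>. dev \<omega> {e \<in> R. crosses S e} > \<delta> * cut_val q E S}
        \<le> 2 * exp (- (\<kappa> * cut_val q E S))"
    and \<kappa>: "6 * ln (real (card V)) \<le> \<kappa> * k"
  shows "measure_pmf.prob M {\<omega>. \<exists>S\<subseteq>V. dev \<omega> {e \<in> R. crosses S e} > \<delta> * cut_val q E S}
      \<le> 4 / (real (card V))\<^sup>2"
proof -
  let ?n = "card V"
  define proj where "proj S = {e \<in> R. crosses S e}" for S
  have Q0: "0 \<le> cut_val q E S" for S
    unfolding cut_val_def by (intro sum_nonneg) (use q in auto)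
  have "\<exists>rep. \<forall>S. S \<subseteq> V \<longrightarrow> rep (proj S) \<subseteq> V \<and> proj (rep (proj S)) = proj S \<and>
      cut_val q E (rep (proj S)) \<le> cut_val q E S"
  proof -
    define rep where "rep P = arg_min_on (cut_val q E) {S. S \<subseteq> V \<and> proj S = P}" for P
    have "rep (proj S) \<subseteq> V \<and> proj (rep (proj S)) = proj S \<and> cut_val q E (rep (proj S)) \<le> cut_val q E S"
      if "S \<subseteq> V" for S
    proof -
      have fin: "finite {S'. S' \<subseteq> V \<and> proj S' = proj S}" using \<open>finite V\<close> by simp
      have mem: "S \<in> {S'. S' \<subseteq> V \<and> proj S' = proj S}" using that by simp
      show ?thesis
        using arg_min_if_finite(1)[OF fin, of "cut_val q E"] arg_min_least[OF fin _ mem, of "cut_val q E"] mem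
        unfolding rep_def by blast
    qed
    then show ?thesis by blast
  qed
  then obtain rep where rep: "\<And>S. S \<subseteq> V \<Longrightarrow> rep (proj S) \<subseteq> V"
    "\<And>S. S \<subseteq> V \<Longrightarrow> proj (rep (proj S)) = proj S"
    "\<And>S. S \<subseteq> V \<Longrightarrow> cut_val q E (rep (proj S)) \<le> cut_val q E S" by blast
  define \<C> where "\<C> = rep ` proj ` {S. S \<subseteq> V \<and> proj S \<noteq> {}}"
  have fin\<C>: "finite \<C>" unfolding \<C>_def using \<open>finite V\<close> by simp
  have \<C>V: "S \<subseteq> V" if "S \<in> \<C>" for S using that rep by (auto simp: \<C>_def)
  have \<C>ne: "proj S \<noteq> {}" if "S \<in> \<C>" for S using that rep by (auto simp: \<C>_def)
  have inj: "inj_on proj \<C>"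
  proof (rule inj_onI)
    fix S S' assume "S \<in> \<C>" "S' \<in> \<C>" "proj S = proj S'"
    then show "S = S'" unfolding \<C>_def using rep(2) by auto
  qed
  have k_le: "k \<le> cut_val q E S" if "S \<in> \<C>" for S
    using \<C>ne[OF that] \<C>V[OF that] heavy by (auto simp: proj_def)
  define lev where "lev S = nat \<lfloor>cut_val q E S / k\<rfloor>" for S
  have lev: "1 \<le> lev S" "real (lev S) \<le> cut_val q E S / k" "cut_val q E S / k \<le> real (lev S + 1)"
    if "S \<in> \<C>" for S
  proof -
    have 1: "1 \<le> cut_val q E S / k" using k_le[OF that] \<open>0 < k\<close> by (simp add: le_divide_eq)
    then show "1 \<le> lev S" "real (lev S) \<le> cut_val q E S / k" "cut_val q E S / k \<le> real (lev S + 1)"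
      unfolding lev_def by linarith+
  qed
  have card_lev: "real (card {S \<in> \<C>. lev S = j}) \<le> real ?n ^ (2 * (j + 1))" if "1 \<le> j" for j
  proof -
    have "card {S \<in> \<C>. lev S = j} \<le> ?n ^ (2 * (j + 1))"
    proof (rule card_cut_family_le_power[OF assms(1,2) _ E R q heavy \<open>0 < k\<close>])
      show "inj_on (\<lambda>S. {e \<in> R. crosses S e}) {S \<in> \<C>. lev S = j}"
        using inj unfolding proj_def by (rule inj_on_subset) auto
      show "2 * cut_val q E S \<le> real (2 * (j + 1)) * k" if "S \<in> {S \<in> \<C>. lev S = j}" for S
        using lev(3)[of S] that \<open>0 < k\<close> by (auto simp: field_simps)
    qed (use fin\<C> that n in auto)
    then show ?thesis by (metis of_nat_le_iff of_nat_power)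
  qed
  have tail': "measure_pmf.prob M {\<omega>. dev \<omega> (proj S) > \<delta> * cut_val q E S} \<le> 2 * (1 / real ?n) ^ (6 * lev S)"
    if "S \<in> \<C>" for S
  proof -
    have ln: "0 \<le> ln (real ?n)" using n by simp
    have "real (6 * lev S) * ln (real ?n) = real (lev S) * (6 * ln (real ?n))" by simp
    also have "\<dots> \<le> (cut_val q E S / k) * (6 * ln (real ?n))"
      by (intro mult_right_mono lev that) (use ln in auto)
    also have "\<dots> \<le> (cut_val q E S / k) * (\<kappa> * k)"
      by (intro mult_left_mono \<kappa> divide_nonneg_pos Q0 \<open>0 < k\<close>)
    also have "\<dots> = \<kappa> * cut_val q E S" using \<open>0 < k\<close> by simp
    finally have "exp (- (\<kappa> * cut_val q E S)) \<le> exp (real (6 * lev S) * - ln (real ?n))" by simp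
    also have "\<dots> = (1 / real ?n) ^ (6 * lev S)"
      unfolding exp_of_nat_mult using n by (simp add: exp_minus inverse_eq_divide)
    finally show ?thesis using tail[OF \<C>V[OF that]] unfolding proj_def[symmetric] by linarith
  qed
  \<comment> \<open>Inserting 1 keeps \<open>Max\<close> meaningful when no cut has a nonempty
    projection.\<close>
  define J where "J = Max (insert 1 (lev ` \<C>))"
  have J: "lev S \<in> {1..J}" if "S \<in> \<C>" for S
    unfolding J_def using that lev(1)[OF that] fin\<C> by auto
  have "measure_pmf.prob M {\<omega>. \<exists>S\<subseteq>V. dev \<omega> (proj S) > \<delta> * cut_val q E S} \<le>
      measure_pmf.prob M (\<Union>S\<in>\<C>. {\<omega>. dev \<omega> (proj S) > \<delta> * cut_val q E S})"
  proof (rule measure_pmf.finite_measure_mono; safe?)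
    fix \<omega> S assume S: "S \<subseteq> V" and *: "dev \<omega> (proj S) > \<delta> * cut_val q E S"
    \<comment> \<open>An empty projection deviates by 0 and therefore never fails.\<close>
    have "proj S \<noteq> {}" using * dev0 mult_nonneg_nonneg[OF \<open>0 \<le> \<delta>\<close> Q0[of S]] by auto
    then have "rep (proj S) \<in> \<C>" using S by (auto simp: \<C>_def)
    moreover have "dev \<omega> (proj (rep (proj S))) > \<delta> * cut_val q E (rep (proj S))"
      using * rep[OF S] mult_left_mono[OF rep(3)[OF S] \<open>0 \<le> \<delta>\<close>] by simp
    ultimately show "\<omega> \<in> (\<Union>S\<in>\<C>. {\<omega>. dev \<omega> (proj S) > \<delta> * cut_val q E S})" by blast
  qed simp
  also have "\<dots> \<le> (\<Sum>S\<in>\<C>. measure_pmf.prob M {\<omega>. dev \<omega> (proj S) > \<delta> * cut_val q E S})"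
    by (rule measure_UNION_le) (use fin\<C> in auto)
  also have "\<dots> \<le> (\<Sum>S\<in>\<C>. 2 * (1 / real ?n) ^ (6 * lev S))"
    by (intro sum_mono tail')
  also have "\<dots> = (\<Sum>j\<in>{1..J}. \<Sum>S | S \<in> \<C> \<and> lev S = j. 2 * (1 / real ?n) ^ (6 * lev S))"
    by (rule sum.group[symmetric]) (use fin\<C> J in auto)
  also have "\<dots> = (\<Sum>j\<in>{1..J}. real (card {S \<in> \<C>. lev S = j}) * (2 * (1 / real ?n) ^ (6 * j)))"
    by (intro sum.cong refl) simp
  also have "\<dots> \<le> (\<Sum>j\<in>{1..J}. real ?n ^ (2 * (j + 1)) * (2 * (1 / real ?n) ^ (6 * j)))"
    by (intro sum_mono mult_right_mono card_lev) auto
  also have "\<dots> \<le> 4 / (real ?n)\<^sup>2"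
    by (rule geometric_tail_le) (use n in auto)
  finally show ?thesis unfolding proj_def .
qed


section \<open>Contraction of Nagamochi--Ibaraki forests\<close>

lemma walk_append: "walk H u (es @ fs) v \<longleftrightarrow> (\<exists>w. walk H u es w \<and> walk H w fs v)"
  by (induction es arbitrary: u) auto

lemma walk_rev: "walk H u es v \<Longrightarrow> walk H v (rev es) u"
  by (induction es arbitrary: u) (auto simp: walk_append insert_commute)

lemma connected_in_refl: "connected_in H T u u"
  unfolding connected_in_def by (rule exI[of _ "[]"]) simp

lemma connected_in_sym: "connected_in H T u v \<Longrightarrow> connected_in H T v u"
  unfolding connected_in_def using walk_rev by (metis set_rev)

lemma connected_in_trans: "connected_in H T u v \<Longrightarrow> connected_in H T v w \<Longrightarrow> connected_in H T u w"
  unfolding connected_in_def by (metis walk_append set_append Un_least)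

lemma connected_in_edge: "e \<in> T \<Longrightarrow> ends H e = {u, v} \<Longrightarrow> connected_in H T u v"
  unfolding connected_in_def by (rule exI[of _ "[e]"]) auto

lemma connected_in_mono: "connected_in H T u v \<Longrightarrow> T \<subseteq> T' \<Longrightarrow> connected_in H T' u v"
  unfolding connected_in_def by blast

lemma walk_imp_trail:
  assumes "walk H u es v"
  shows "\<exists>fs. distinct fs \<and> set fs \<subseteq> set es \<and> walk H u fs v"
  using assms
proof (induction "length es" arbitrary: es rule: less_induct)
  case less
  show ?case
  proof (cases "distinct es")
    case True
    then show ?thesis using less.prems by blast
  next
    case False
    then obtain as e bs cs where es: "es = as @ [e] @ bs @ [e] @ cs"
      using not_distinct_decomp by blast
    from less.prems obtain x y z w where *: "walk H u as x" "ends H e = {x, y}"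
      "ends H e = {z, w}" "walk H w cs v"
      by (auto simp: es walk_append)
    \<comment> \<open>The second traversal of \<open>e\<close> has the direction of the first or the
      opposite one. The stretch in between is cut out, keeping one copy of \<open>e\<close> in the
      first case and none in the second.\<close>
    then consider "w = y" | "w = x" by (auto simp: doubleton_eq_iff)
    then have "\<exists>fs. length fs < length es \<and> set fs \<subseteq> set es \<and> walk H u fs v"
    proof cases
      case 1
      then show ?thesis using * by (intro exI[of _ "as @ e # cs"]) (auto simp: es walk_append)
    next
      case 2
      then show ?thesis using * by (intro exI[of _ "as @ cs"]) (auto simp: es walk_append)
    qed
    then show ?thesis using less.hyps by (meson order_trans)
  qed
qed

lemma card_image_coarsen:
  assumes "finite V" and coarse: "\<And>x y. x \<in> V \<Longrightarrow> y \<in> V \<Longrightarrow> f x = f y \<Longrightarrow> g x = g y"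
    and "u \<in> V" "v \<in> V" "g u = g v" "f u \<noteq> f v"
  shows "card (g ` V) < card (f ` V)"
proof -
  define h where "h z = g (inv_into V f z)" for z
  have h: "h (f x) = g x" if "x \<in> V" for x
    using coarse[of "inv_into V f (f x)" x] that
    by (simp add: h_def inv_into_into f_inv_into_f)
  have "g ` V = h ` f ` V" using h by (force simp: image_image)
  moreover have "\<not> inj_on h (f ` V)" using h assms(3-6) by (auto simp: inj_on_def)
  ultimately show ?thesis
    using assms(1) by (metis card_image_le eq_card_imp_inj_on finite_imageI le_neq_implies_less)
qed

definition component :: "('v, 'e) multigraph \<Rightarrow> 'e set \<Rightarrow> 'v \<Rightarrow> 'v set" where
  "component H T u = {v \<in> verts H. connected_in H T u v}"

lemma component_eq_iff:
  assumes "u \<in> verts H" "v \<in> verts H"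
  shows "component H T u = component H T v \<longleftrightarrow> connected_in H T u v"
  using assms connected_in_refl[of H T] connected_in_sym[of H T] connected_in_trans[of H T]
  unfolding component_def by blast

lemma loopless_ends:
  assumes "loopless_multigraph H" "e \<in> edges H"
  obtains u v where "ends H e = {u, v}" "u \<noteq> v" "u \<in> verts H" "v \<in> verts H"
  using assms unfolding loopless_multigraph_def card_2_iff by blast

lemma card_component_less:
  assumes "loopless_multigraph H" "T \<subseteq> T'" "e \<in> T'" "ends H e = {u, v}" "u \<in> verts H" "v \<in> verts H"
    "\<not> connected_in H T u v"
  shows "card (component H T' ` verts H) < card (component H T ` verts H)"
proof (rule card_image_coarsen)
  show "finite (verts H)" using assms(1) by (simp add: loopless_multigraph_def)
  show "component H T' u = component H T' v" "component H T u \<noteq> component H T v"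
    using assms by (simp_all add: component_eq_iff connected_in_edge)
  fix x y assume "x \<in> verts H" "y \<in> verts H" "component H T x = component H T y"
  then show "component H T' x = component H T' y"
    using assms(2) by (auto simp: component_eq_iff intro: connected_in_mono)
qed (use assms in auto)

lemma is_forest_subset: "is_forest H T \<Longrightarrow> T' \<subseteq> T \<Longrightarrow> is_forest H T'"
  unfolding is_forest_def by blast

text \<open>Built up edge by edge, a forest loses a component with each edge: a connection already
  present would shorten to a trail and be closed by the new edge. Hence edges plus components never
  exceed the vertices.\<close>

lemma card_forest_le:
  assumes H: "loopless_multigraph H" and "is_forest H T"
  shows "card T \<le> card (verts H)"
proof -
  have "finite T" using assms finite_subset unfolding is_forest_def loopless_multigraph_def by blast
  then have "is_forest H T \<Longrightarrow> card T + card (component H T ` verts H) \<le> card (verts H)"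
  proof (induction T rule: finite_induct)
    case empty
    then show ?case using H by (simp add: card_image_le loopless_multigraph_def)
  next
    case (insert e T)
    have e: "e \<in> edges H" using insert.prems by (auto simp: is_forest_def)
    then obtain u v where uv: "ends H e = {u, v}" "u \<in> verts H" "v \<in> verts H"
      using loopless_ends[OF H] by metis
    have "\<not> connected_in H T u v"
    proof
      assume "connected_in H T u v"
      then obtain fs where fs: "distinct fs" "set fs \<subseteq> T" "walk H u fs v"
        unfolding connected_in_def using walk_imp_trail by (metis order_trans)
      have "walk H v (e # fs) v" using fs uv by (auto simp: insert_commute)
      moreover have "distinct (e # fs)" "set (e # fs) \<subseteq> insert e T" using fs insert.hyps by auto
      ultimately show False using insert.prems unfolding is_forest_def by blast
    qed
    then have "card (component H (insert e T) ` verts H) < card (component H T ` verts H)"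
      using card_component_less[OF H _ _ uv] by blast
    moreover have "is_forest H T" using insert.prems is_forest_subset by blast
    ultimately show ?case using insert by simp
  qed
  then show ?thesis using assms by simp
qed

lemma single_edge_forest:
  assumes "loopless_multigraph H" "e \<in> edges H"
  shows "is_forest H {e}"
proof -
  obtain u v where uv: "ends H e = {u, v}" "u \<noteq> v" using loopless_ends[OF assms] by metis
  have False if "es \<noteq> []" "distinct es" "set es \<subseteq> {e}" "walk H x es x" for x es
  proof -
    have "length es \<le> 1" using that distinct_card[of es] card_mono[of "{e}" "set es"] by simp
    then have "es = [e]" using that(1,3) by (cases es) simp_all
    then have "ends H e = {x, x}" using that(4) by simp
    then show False using uv by (auto simp: doubleton_eq_iff)
  qed
  then show ?thesis using assms unfolding is_forest_def by blast
qed

text \<open>Guarantees progress of the contraction loop. If forest \<open>J\<close> is empty,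
  maximality leaves no edge over, since a single edge is a forest; the \<open>J - 1\<close> earlier
  forests then exhaust \<open>H\<close> with at most \<open>card (verts H)\<close> edges
  each.\<close>

lemma NI_forest_nonempty:
  assumes H: "loopless_multigraph H" and NI: "NI_forests H T" and "1 \<le> J"
    and many: "(J - 1) * card (verts H) < card (edges H)"
  shows "T J \<noteq> {}"
proof
  assume "T J = {}"
  have mf: "maximal_forest H (edges H - (\<Union>l\<in>{1..<j}. T l)) (T j)" if "1 \<le> j" for j
    using NI that unfolding NI_forests_def by blast
  have "edges H \<subseteq> (\<Union>l\<in>{1..<J}. T l)"
  proof
    fix e assume e: "e \<in> edges H"
    show "e \<in> (\<Union>l\<in>{1..<J}. T l)"
    proof (rule ccontr)
      assume "e \<notin> (\<Union>l\<in>{1..<J}. T l)"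
      then have "{} \<subset> {e}" "{e} \<subseteq> edges H - (\<Union>l\<in>{1..<J}. T l)" using e by auto
      moreover have "\<forall>T'. {} \<subset> T' \<and> T' \<subseteq> edges H - (\<Union>l\<in>{1..<J}. T l) \<longrightarrow> \<not> is_forest H T'"
        using mf[OF \<open>1 \<le> J\<close>] \<open>T J = {}\<close> unfolding maximal_forest_def by simp
      ultimately have "\<not> is_forest H {e}" by blast
      then show False using single_edge_forest[OF H e] by blast
    qed
  qed
  moreover have forest: "is_forest H (T l)" if "1 \<le> l" for l
    using mf[OF that] unfolding maximal_forest_def by blast
  moreover have fin: "finite (T l)" if "1 \<le> l" for l
    using forest[OF that] H finite_subset unfolding is_forest_def loopless_multigraph_def by blast
  ultimately have "card (edges H) \<le> card (\<Union>l\<in>{1..<J}. T l)"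
    by (intro card_mono) auto
  also have "\<dots> \<le> (\<Sum>l\<in>{1..<J}. card (T l))" by (rule card_UN_le) simp
  also have "\<dots> \<le> (\<Sum>l\<in>{1..<J}. card (verts H))"
    by (intro sum_mono card_forest_le[OF H] forest) auto
  finally show False using many by simp
qed

section \<open>Block partitions under contraction\<close>

text \<open>\<open>represents V X k \<beta> H\<close>: \<open>H\<close> arises from \<open>(V, X)\<close> by merging each \<open>v\<close> into the block \<open>\<beta> v\<close>,
  and vertices in a common block are \<open>k\<close>-edge-connected in \<open>(V, X)\<close>, expressed through cuts.\<close>

definition represents ::
    "'a set \<Rightarrow> 'a set set \<Rightarrow> real \<Rightarrow> ('a \<Rightarrow> 'a set) \<Rightarrow> 'a block_graph \<Rightarrow> bool" where
  "represents V X k \<beta> H \<longleftrightarrow>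
     verts H = \<beta> ` V \<and> edges H = {e \<in> X. card (\<beta> ` e) = 2} \<and> (\<forall>e\<in>edges H. ends H e = \<beta> ` e) \<and>
     (\<forall>v\<in>V. v \<in> \<beta> v \<and> \<beta> v \<subseteq> V \<and> (\<forall>u\<in>\<beta> v. \<beta> u = \<beta> v)) \<and>
     (\<forall>u\<in>V. \<forall>v\<in>V. \<beta> u = \<beta> v \<longrightarrow>
        (\<forall>S. separates S u v \<longrightarrow> k \<le> real (card {e \<in> X. crosses S e})))"

lemma representsD:
  assumes "represents V X k \<beta> H"
  shows "verts H = \<beta> ` V" "edges H = {e \<in> X. card (\<beta> ` e) = 2}"
    "\<And>e. e \<in> edges H \<Longrightarrow> ends H e = \<beta> ` e" "\<And>v. v \<in> V \<Longrightarrow> v \<in> \<beta> v" "\<And>v. v \<in> V \<Longrightarrow> \<beta> v \<subseteq> V"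
    "\<And>u v. v \<in> V \<Longrightarrow> u \<in> \<beta> v \<Longrightarrow> \<beta> u = \<beta> v"
    "\<And>u v S. u \<in> V \<Longrightarrow> v \<in> V \<Longrightarrow> \<beta> u = \<beta> v \<Longrightarrow> separates S u v \<Longrightarrow>
      k \<le> real (card {e \<in> X. crosses S e})"
proof -
  note r = assms[unfolded represents_def]
  note blocks = r[THEN conjunct2, THEN conjunct2, THEN conjunct2, THEN conjunct1, THEN bspec]
  show "verts H = \<beta> ` V" by (rule r[THEN conjunct1])
  show "edges H = {e \<in> X. card (\<beta> ` e) = 2}" by (rule r[THEN conjunct2, THEN conjunct1])
  show "ends H e = \<beta> ` e" if "e \<in> edges H" for e
    by (rule r[THEN conjunct2, THEN conjunct2, THEN conjunct1, THEN bspec, OF that])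
  show "v \<in> \<beta> v" if "v \<in> V" for v by (rule blocks[OF that, THEN conjunct1])
  show "\<beta> v \<subseteq> V" if "v \<in> V" for v by (rule blocks[OF that, THEN conjunct2, THEN conjunct1])
  show "\<beta> u = \<beta> v" if "v \<in> V" "u \<in> \<beta> v" for u v
    by (rule blocks[OF that(1), THEN conjunct2, THEN conjunct2, THEN bspec, OF that(2)])
  show "k \<le> real (card {e \<in> X. crosses S e})"
    if "u \<in> V" "v \<in> V" "\<beta> u = \<beta> v" "separates S u v" for u v S
    using r[THEN conjunct2, THEN conjunct2, THEN conjunct2, THEN conjunct2] that by blast
qed

lemma represents_loopless:
  assumes "simple_graph V X" "represents V X k \<beta> H"
  shows "loopless_multigraph H"
proof -
  have "finite X" using assms(1) unfolding simple_graph_def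
    by (intro finite_subset[of X "Pow V"]) auto
  moreover have "e \<subseteq> V" if "e \<in> X" for e using that assms(1) unfolding simple_graph_def by auto
  moreover from this have "\<beta> ` e \<subseteq> \<beta> ` V" if "e \<in> X" for e using that by blast
  ultimately show ?thesis
    using assms(1) representsD(1-3)[OF assms(2)]
    unfolding simple_graph_def loopless_multigraph_def by simp
qed

lemma represents_block_graph:
  assumes "simple_graph V X"
  shows "represents V X k (\<lambda>v. {v}) (block_graph V X)"
proof -
  have "card ((\<lambda>v. {v}) ` e) = 2" if "e \<in> X" for e
    using that assms card_image[of "\<lambda>v. {v}" e] by (simp add: simple_graph_def inj_on_def)
  then show ?thesis unfolding represents_def block_graph_def separates_def by auto
qed

lemma represents_edge:
  assumes "simple_graph V X" "represents V X k \<beta> H" "e \<in> edges H"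
  obtains p q where "e = {p, q}" "p \<in> V" "q \<in> V" "ends H e = {\<beta> p, \<beta> q}" "e \<in> X"
proof -
  have e: "e \<in> X" "ends H e = \<beta> ` e" using assms unfolding represents_def by auto
  then obtain p q where "e = {p, q}" "p \<in> V" "q \<in> V"
    using assms(1) unfolding simple_graph_def card_2_iff by (metis insert_subset)
  then show ?thesis using that[of p q] e by simp
qed

text \<open>A cut that splits no block is a cut of the contracted graph, so it must contain \<open>j\<close> edges there.\<close>

lemma represents_NI_edge_heavy:
  assumes X: "simple_graph V X" and rep: "represents V X k \<beta> H" and NI: "NI_forests H T"
    and j: "1 \<le> j" "k \<le> real j" and e: "e \<in> T j" and "crosses S e"
  shows "k \<le> real (card {f \<in> X. crosses S f})"
proof (cases "\<exists>u\<in>V. \<exists>v\<in>V. \<beta> u = \<beta> v \<and> separates S u v")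
  case True
  then show ?thesis using rep unfolding represents_def by blast
next
  case False
  have blocks: "u \<in> S \<longleftrightarrow> v \<in> S" if "u \<in> V" "v \<in> V" "\<beta> u = \<beta> v" for u v
    using False that unfolding separates_def by blast
  have "edges H = (\<Union>j\<in>{1..}. T j)" using NI unfolding NI_forests_def by blast
  then have TE: "T l \<subseteq> edges H" if "1 \<le> l" for l using that by auto
  have eH: "e \<in> edges H" using TE e j by auto
  obtain p q where pq: "e = {p, q}" "p \<in> V" "q \<in> V" "ends H e = {\<beta> p, \<beta> q}"
    using represents_edge[OF X rep eH] by metis
  define U where "U = (\<Union>l\<in>{1..j}. T l)"
  have UE: "U \<subseteq> edges H" unfolding U_def using TE by (intro UN_least) simp
  have UX: "U \<subseteq> X" using UE rep by (auto simp: represents_def)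
  have finX: "finite X" using X unfolding simple_graph_def
    by (intro finite_subset[of X "Pow V"]) auto
  define D where "D = {f \<in> U. crosses S f}"
  have ec: "edge_connected_in H U j (\<beta> p) (\<beta> q)"
    using NI j e pq(4) unfolding NI_forests_def U_def by blast
  \<comment> \<open>No block is split, so a walk without crossing edges stays on one side of
    \<open>S\<close>. Removing \<open>D\<close> thus disconnects the ends of \<open>e\<close>, and
    edge-connectivity forces at least \<open>j\<close> edges into \<open>D\<close>.\<close>
  have no_walk: "q' \<in> S \<longleftrightarrow> p' \<in> S"
    if "walk H (\<beta> p') es (\<beta> q')" "set es \<subseteq> U - D" "p' \<in> V" "q' \<in> V" for p' q' es
    using that
  proof (induction es arbitrary: p')
    case Nil
    then show ?case using blocks[of p' q'] by auto
  next
    case (Cons f fs)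
    then obtain w where w: "ends H f = {\<beta> p', w}" "walk H w fs (\<beta> q')" by auto
    have f: "f \<in> U" "\<not> crosses S f" using Cons.prems by (auto simp: D_def)
    obtain x y where xy: "f = {x, y}" "x \<in> V" "y \<in> V" "ends H f = {\<beta> x, \<beta> y}"
      using represents_edge[OF X rep subsetD[OF UE f(1)]] by metis
    have "x \<in> S \<longleftrightarrow> y \<in> S" using f(2) unfolding xy(1) crosses_doubleton separates_def by simp
    from w(1) xy(4) consider "\<beta> p' = \<beta> x" "w = \<beta> y" | "\<beta> p' = \<beta> y" "w = \<beta> x"
      by (auto simp: doubleton_eq_iff)
    then show ?case
    proof cases
      case 1
      have "q' \<in> S \<longleftrightarrow> y \<in> S" by (rule Cons.IH) (use 1 w Cons.prems xy in auto)
      then show ?thesis using \<open>x \<in> S \<longleftrightarrow> y \<in> S\<close> blocks[OF Cons.prems(3) xy(2) 1(1)] by simp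
    next
      case 2
      have "q' \<in> S \<longleftrightarrow> x \<in> S" by (rule Cons.IH) (use 2 w Cons.prems xy in auto)
      then show ?thesis using \<open>x \<in> S \<longleftrightarrow> y \<in> S\<close> blocks[OF Cons.prems(3) xy(3) 2(1)] by simp
    qed
  qed
  have "\<not> connected_in H (U - D) (\<beta> p) (\<beta> q)"
    using no_walk[of p _ q] pq(2,3) \<open>crosses S e\<close>
    unfolding connected_in_def pq(1) crosses_doubleton separates_def by metis
  moreover have finD: "finite D" unfolding D_def using finite_subset[OF UX finX] by simp
  ultimately have "j \<le> card D"
    using ec unfolding edge_connected_in_def by (metis (no_types, lifting) D_def mem_Collect_eq not_less subsetI)
  also have "\<dots> \<le> card {f \<in> X. crosses S f}"
    by (rule card_mono) (use UX finX D_def in auto)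
  finally show ?thesis using j(2) by linarith
qed

text \<open>Two vertices of a common new block are joined by a walk in \<open>T j\<close> between
  old blocks. A cut separating them splits an old block on the way, and is heavy by
  \<open>represents\<close>, or crosses an edge of the walk, and is heavy by
  \<open>represents_NI_edge_heavy\<close>.\<close>

lemma contract_represents:
  assumes X: "simple_graph V X" and rep: "represents V X k \<beta> H" and NI: "NI_forests H T"
    and j: "1 \<le> j" "k \<le> real j"
  shows "\<exists>\<beta>'. represents V X k \<beta>' (contract H (T j))"
proof -
  let ?con = "connected_in H (T j)"
  define \<beta>' where "\<beta>' v = merged_block H (T j) (\<beta> v)" for v
  note rep1 = representsD[OF rep]
  have XV: "e \<subseteq> V" "card e = 2" if "e \<in> X" for e using X that unfolding simple_graph_def by auto
  have \<beta>': "\<beta>' v = {u \<in> V. ?con (\<beta> v) (\<beta> u)}" if "v \<in> V" for v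
  proof (intro equalityI subsetI)
    fix u assume "u \<in> \<beta>' v"
    then obtain w where w: "w \<in> V" "?con (\<beta> v) (\<beta> w)" "u \<in> \<beta> w"
      unfolding \<beta>'_def merged_block_def rep1(1) by blast
    then show "u \<in> {u \<in> V. ?con (\<beta> v) (\<beta> u)}"
      using rep1(5)[OF w(1)] rep1(6)[OF w(1) w(3)] by auto
  next
    fix u assume "u \<in> {u \<in> V. ?con (\<beta> v) (\<beta> u)}"
    then show "u \<in> \<beta>' v"
      unfolding \<beta>'_def merged_block_def rep1(1) using rep1(4)[of u] by auto
  qed
  have \<beta>'_eq: "\<beta>' u = \<beta>' v \<longleftrightarrow> ?con (\<beta> u) (\<beta> v)" if "u \<in> V" "v \<in> V" for u v
  proof
    assume "\<beta>' u = \<beta>' v"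
    then have "v \<in> \<beta>' u" using \<beta>'[OF that(2)] that(2) connected_in_refl by auto
    then show "?con (\<beta> u) (\<beta> v)" using \<beta>'[OF that(1)] by simp
  next
    assume *: "?con (\<beta> u) (\<beta> v)"
    have "?con (\<beta> u) b \<longleftrightarrow> ?con (\<beta> v) b" for b
      using connected_in_trans[OF *] connected_in_trans[OF connected_in_sym[OF *]] by blast
    then show "\<beta>' u = \<beta>' v" unfolding \<beta>'[OF that(1)] \<beta>'[OF that(2)] by simp
  qed
  have TE: "T j \<subseteq> edges H" using NI j(1) unfolding NI_forests_def by auto
  have heavy: "k \<le> real (card {e \<in> X. crosses S e})"
    if "u \<in> V" "v \<in> V" "\<beta>' u = \<beta>' v" "separates S u v" for u v S
  proof -
    have "?con (\<beta> u) (\<beta> v)" using \<beta>'_eq that by simp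
    then obtain es where es: "set es \<subseteq> T j" "walk H (\<beta> u) es (\<beta> v)" unfolding connected_in_def by blast
    from es \<open>u \<in> V\<close> \<open>separates S u v\<close> show ?thesis
    proof (induction es arbitrary: u)
      case Nil
      then show ?case using rep1(7) \<open>v \<in> V\<close> by simp
    next
      case (Cons f fs)
      then obtain w where w: "ends H f = {\<beta> u, w}" "walk H w fs (\<beta> v)" by auto
      have f: "f \<in> T j" "f \<in> edges H" using Cons.prems TE by auto
      obtain x y where xy: "f = {x, y}" "x \<in> V" "y \<in> V" "ends H f = {\<beta> x, \<beta> y}"
        using represents_edge[OF X rep f(2)] by metis
      obtain x y where xy: "f = {x, y}" "x \<in> V" "y \<in> V" "\<beta> x = \<beta> u" "w = \<beta> y"
      proof -
        from w(1) xy(4) consider "\<beta> u = \<beta> x" "w = \<beta> y" | "\<beta> u = \<beta> y" "w = \<beta> x"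
          by (auto simp: doubleton_eq_iff)
        then show ?thesis using that[of x y] that[of y x] xy by cases auto
      qed
      from Cons.prems(4) consider "separates S u x" | "separates S x y" | "separates S y v"
        unfolding separates_def by blast
      then show ?case
      proof cases
        case 1
        then show ?thesis using rep1(7)[of u x S] Cons.prems(3) xy(2,4) by simp
      next
        case 2
        then have "crosses S f" unfolding xy(1) crosses_doubleton .
        then show ?thesis by (rule represents_NI_edge_heavy[OF X rep NI j f(1)])
      next
        case 3
        moreover have "set fs \<subseteq> T j" "walk H (\<beta> y) fs (\<beta> v)" using Cons.prems(1) w(2) xy(5) by auto
        ultimately show ?thesis using Cons.IH xy(3) by blast
      qed
    qed
  qed
  have E: "edges (contract H (T j)) = {e \<in> X. card (\<beta>' ` e) = 2}"
  proof -
    \<comment> \<open>Different new blocks come from different old ones, so an edge surviving the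
      contraction already joined two blocks before it.\<close>
    have "card (\<beta> ` e) = 2" if "e \<in> X" "card (\<beta>' ` e) = 2" for e
    proof -
      have "card (\<beta>' ` e) \<le> card (\<beta> ` e)"
        unfolding \<beta>'_def image_image[symmetric, of "merged_block H (T j)" \<beta>]
        using XV(2)[OF that(1)] by (intro card_image_le finite_imageI) (simp add: card_ge_0_finite)
      moreover have "card (\<beta> ` e) \<le> card e"
        using XV(2)[OF that(1)] by (intro card_image_le) (simp add: card_ge_0_finite)
      ultimately show ?thesis using that XV(2)[OF that(1)] by simp
    qed
    moreover have "merged_block H (T j) ` ends H e = \<beta>' ` e" if "e \<in> edges H" for e
      using rep1(3)[OF that] by (simp add: \<beta>'_def image_image)
    ultimately show ?thesis unfolding contract_def using rep1(2) by auto
  qed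
  have "represents V X k \<beta>' (contract H (T j))"
    unfolding represents_def
  proof (intro conjI ballI impI allI)
    show "verts (contract H (T j)) = \<beta>' ` V"
      by (simp add: contract_def rep1(1) \<beta>'_def image_image)
    show "edges (contract H (T j)) = {e \<in> X. card (\<beta>' ` e) = 2}" by (rule E)
    show "ends (contract H (T j)) e = \<beta>' ` e" if "e \<in> edges (contract H (T j))" for e
      using that rep1(3)[of e] by (auto simp: contract_def \<beta>'_def image_image)
    fix v assume v: "v \<in> V"
    show "v \<in> \<beta>' v" "\<beta>' v \<subseteq> V" using \<beta>'[OF v] v connected_in_refl by auto
    show "\<beta>' u = \<beta>' v" if "u \<in> \<beta>' v" for u
    proof -
      have "u \<in> V" "?con (\<beta> u) (\<beta> v)" using that \<beta>'[OF v] by (auto intro: connected_in_sym)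
      then show ?thesis using \<beta>'_eq v by blast
    qed
  next
    fix u v S assume "u \<in> V" "v \<in> V" "\<beta>' u = \<beta>' v" "separates S u v"
    then show "k \<le> real (card {e \<in> X. crosses S e})" by (rule heavy)
  qed
  then show ?thesis by blast
qed

lemma card_verts_contract_less:
  assumes H: "loopless_multigraph H" and "T \<subseteq> edges H" "T \<noteq> {}"
  shows "card (verts (contract H T)) < card (verts H)"
proof -
  obtain e u v where e: "e \<in> T" "ends H e = {u, v}" "u \<noteq> v" "u \<in> verts H" "v \<in> verts H"
    using assms loopless_ends[OF H] by (metis ex_in_conv subset_iff)
  have "card (merged_block H T ` verts H) < card ((\<lambda>b. b) ` verts H)"
  proof (rule card_image_coarsen)
    show "finite (verts H)" using H by (simp add: loopless_multigraph_def)
    have "component H T u = component H T v"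
      using e by (simp add: component_eq_iff connected_in_edge)
    then show "merged_block H T u = merged_block H T v"
      unfolding merged_block_def component_def by simp
  qed (use e in auto)
  then show ?thesis by (simp add: contract_def)
qed

text \<open>The loop is deterministic, and each contraction lowers the number of vertices, so it
  terminates without loss of probability mass. The last clause, that a sparse graph is left
  untouched, later bounds the number of levels.\<close>

lemma contract_loop_result:
  assumes X: "simple_graph V X" and rep: "represents V X k \<beta> H" and NI: "NI_procedure NI" and "0 \<le> k"
  shows "\<exists>H' \<beta>'. contract_loop NI k H = return_spmf H' \<and> represents V X k \<beta>' H' \<and>
    (real (card (edges H)) \<le> 2 * k * real (card (verts H)) \<longrightarrow> H' = H)"
  using rep
proof (induction "card (verts H)" arbitrary: H \<beta> rule: less_induct)
  case less
  show ?case
  proof (cases "real (card (edges H)) > 2 * k * real (card (verts H))")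
    case False
    then have "contract_loop NI k H = return_spmf H" by (subst contract_loop.simps) simp
    then show ?thesis using less.prems by blast
  next
    case True
    define J where "J = nat \<lfloor>k + 1\<rfloor>"
    \<comment> \<open>\<open>k <= J\<close> makes the contracted edges heavy;
      \<open>J - 1 <= k\<close> makes forest \<open>J\<close> nonempty as long as the loop
      runs.\<close>
    have J: "1 \<le> J" "k \<le> real J" "real (J - 1) \<le> k"
      unfolding J_def using \<open>0 \<le> k\<close> by linarith+
    have H: "loopless_multigraph H" by (rule represents_loopless[OF X less.prems])
    then have NIH: "NI_forests H (NI H)" using NI unfolding NI_procedure_def by blast
    have "real ((J - 1) * card (verts H)) \<le> k * real (card (verts H))"
      using J(3) by (simp add: mult_right_mono)
    also have "\<dots> \<le> 2 * k * real (card (verts H))"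
      using \<open>0 \<le> k\<close> by (simp add: mult_right_mono)
    finally have "real ((J - 1) * card (verts H)) < real (card (edges H))" using True by linarith
    then have ne: "NI H J \<noteq> {}" using NI_forest_nonempty[OF H NIH J(1)] by linarith
    have "NI H J \<subseteq> edges H" using NIH J(1) unfolding NI_forests_def by auto
    then have lt: "card (verts (contract H (NI H J))) < card (verts H)"
      using ne by (rule card_verts_contract_less[OF H])
    obtain \<beta>'' where "represents V X k \<beta>'' (contract H (NI H J))"
      using contract_represents[OF X less.prems NIH J(1,2)] by blast
    from less.hyps[OF lt this] True show ?thesis
      by (subst contract_loop.simps) (auto simp: J_def)
  qed
qed

text \<open>A dropped edge has become a self-loop, so its ends share a block.\<close>

lemma represents_dropped_heavy:
  assumes X: "simple_graph V X" and rep: "represents V X k \<beta> H" and e: "e \<in> X - edges H" and "crosses S e"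
  shows "k \<le> real (card {f \<in> X. crosses S f})"
proof -
  obtain p q where pq: "e = {p, q}" "p \<in> V" "q \<in> V"
    using X e unfolding simple_graph_def card_2_iff by (metis DiffD1 insert_subset)
  have "card (\<beta> ` e) \<noteq> 2" using rep e unfolding represents_def by auto
  then have "\<beta> p = \<beta> q" by (auto simp: pq card_2_iff)
  then show ?thesis
    using rep pq(2,3) \<open>crosses S e\<close> unfolding represents_def pq(1) crosses_doubleton by blast
qed

lemma compress_level:
  assumes X: "simple_graph V X" and NI: "NI_procedure NI" and "0 \<le> k"
  obtains H where "contract_loop NI k (block_graph V X) = return_spmf H" "edges H \<subseteq> X"
    "\<And>e S. e \<in> X - edges H \<Longrightarrow> crosses S e \<Longrightarrow> k \<le> real (card {f \<in> X. crosses S f})"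
    "real (card X) \<le> 2 * k * real (card V) \<Longrightarrow> edges H = X"
proof -
  obtain H \<beta> where H: "contract_loop NI k (block_graph V X) = return_spmf H" "represents V X k \<beta> H"
    "real (card X) \<le> 2 * k * real (card V) \<longrightarrow> H = block_graph V X"
    using contract_loop_result[OF X represents_block_graph[OF X] NI \<open>0 \<le> k\<close>]
      card_image[of "\<lambda>v. {v}" V]
    by (auto simp: block_graph_def)
  show ?thesis
    by (rule that[of H])
      (use H(1,3) representsD(2)[OF H(2)] represents_dropped_heavy[OF X H(2)] in
        \<open>auto simp: block_graph_def\<close>)
qed

text \<open>An edge outside these forests lies in one of index above \<open>k\<close>. The blocks
  are singletons here, an instance of the bound for represented graphs.\<close>

lemma initial_forests_heavy:
  assumes E: "simple_graph V E" and NI: "NI_procedure NI" and "0 \<le> k"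
    and e: "e \<in> E - (\<Union>j\<in>{j. 1 \<le> j \<and> real j \<le> k}. NI (block_graph V E) j)" and "crosses S e"
  shows "k \<le> real (card {f \<in> E. crosses S f})"
proof -
  have rep: "represents V E k (\<lambda>v. {v}) (block_graph V E)" by (rule represents_block_graph[OF E])
  have NIE: "NI_forests (block_graph V E) (NI (block_graph V E))"
    using NI represents_loopless[OF E rep] unfolding NI_procedure_def by blast
  then have "(\<Union>j\<in>{1..}. NI (block_graph V E) j) = E"
    unfolding NI_forests_def by (simp add: block_graph_def)
  then obtain j where j: "1 \<le> j" "e \<in> NI (block_graph V E) j" using e by auto
  then have "k \<le> real j" using e by (auto intro: ccontr)
  then show ?thesis
    using represents_NI_edge_heavy[OF E rep NIE j(1) _ j(2) \<open>crosses S e\<close>] by blast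
qed


section \<open>The level loop\<close>

text \<open>Two-stage union bound, from \<open>(1 - r) * (1 - q) >= 1 - (q + r)\<close>. The case
  \<open>r > 1\<close>, where \<open>1 - r\<close> is no probability, is trivial.\<close>

lemma prob_bind_pmf_ge:
  assumes "measure_pmf.prob M B \<le> q" "0 \<le> r"
    and f: "\<And>x. x \<in> set_pmf M \<Longrightarrow> x \<notin> B \<Longrightarrow> 1 - r \<le> measure_pmf.prob (f x) A"
  shows "1 - (q + r) \<le> measure_pmf.prob (bind_pmf M f) A"
proof (cases "r \<le> 1")
  case True
  have "ennreal ((1 - r) * measure_pmf.prob M (- B)) = (\<integral>\<^sup>+x. ennreal (1 - r) * indicator (- B) x \<partial>M)"
    using True by (simp add: nn_integral_cmult_indicator measure_pmf.emeasure_eq_measure ennreal_mult)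
  also have "\<dots> \<le> (\<integral>\<^sup>+x. emeasure (f x) A \<partial>M)"
  proof (intro nn_integral_mono_AE AE_pmfI)
    fix x assume "x \<in> set_pmf M"
    then show "ennreal (1 - r) * indicator (- B) x \<le> emeasure (f x) A"
      using f[of x] by (auto simp: indicator_def measure_pmf.emeasure_eq_measure ennreal_leI)
  qed
  also have "\<dots> = emeasure (bind_pmf M f) A" by simp
  also have "\<dots> = ennreal (measure_pmf.prob (bind_pmf M f) A)"
    by (rule measure_pmf.emeasure_eq_measure)
  finally have "(1 - r) * measure_pmf.prob M (- B) \<le> measure_pmf.prob (bind_pmf M f) A"
    by (simp add: ennreal_le_iff)
  moreover have "measure_pmf.prob M (- B) = 1 - measure_pmf.prob M B"
    using measure_pmf.prob_compl[of B M] by (simp add: Compl_eq_Diff_UNIV)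
  moreover have "(1 - r) * (1 - q) \<le> (1 - r) * (1 - measure_pmf.prob M B)"
    using True assms(1) by (intro mult_left_mono) auto
  moreover have "1 - (q + r) \<le> (1 - r) * (1 - q)"
  proof -
    have "0 \<le> q" using assms(1) measure_nonneg order_trans by blast
    then have "0 \<le> r * q" using assms(2) by simp
    then show ?thesis by (simp add: algebra_simps)
  qed
  ultimately show ?thesis by simp
next
  case False
  have "0 \<le> q" using assms(1) measure_nonneg order_trans by blast
  then have "1 - (q + r) \<le> 0" using False by simp
  then show ?thesis using measure_nonneg order_trans by blast
qed

lemma spmf_prob_bind_pmf_ge:
  assumes "measure_pmf.prob M B \<le> q" "0 \<le> r"
    and "\<And>x. x \<in> set_pmf M \<Longrightarrow> x \<notin> B \<Longrightarrow> 1 - r \<le> measure (measure_spmf (f x)) A"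
  shows "1 - (q + r) \<le> measure (measure_spmf (bind_spmf (spmf_of_pmf M) f)) A"
  using prob_bind_pmf_ge[of M B q r f "Some ` A"] assms
  by (simp add: measure_measure_spmf_conv_measure_pmf)

section \<open>Cut sizes and the halving step\<close>

definition cut_size :: "'a set set \<Rightarrow> 'a set \<Rightarrow> real" where
  "cut_size X S = real (card {e \<in> X. crosses S e})"

lemma cut_val_1: "cut_val (\<lambda>_. 1) X S = cut_size X S"
  by (simp add: cut_val_def cut_size_def)

lemma cut_size_nonneg: "0 \<le> cut_size X S"
  by (simp add: cut_size_def)

lemma cut_size_mono: "finite X \<Longrightarrow> Z \<subseteq> X \<Longrightarrow> cut_size Z S \<le> cut_size X S"
  unfolding cut_size_def by (intro of_nat_mono card_mono) auto

lemma cut_size_split: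
  assumes "finite X" "F \<subseteq> X"
  shows "cut_size X S = cut_size F S + cut_size (X - F) S"
proof -
  have "finite F" using assms finite_subset by blast
  moreover have "{e \<in> X. crosses S e} = {e \<in> F. crosses S e} \<union> {e \<in> X - F. crosses S e}"
    using assms by auto
  ultimately show ?thesis
    unfolding cut_size_def using assms card_Un_disjoint[of "{e \<in> F. crosses S e}" "{e \<in> X - F. crosses S e}"]
    by (simp add: disjoint_iff)
qed

lemma simple_graph_subset: "simple_graph V E \<Longrightarrow> X \<subseteq> E \<Longrightarrow> simple_graph V X"
  unfolding simple_graph_def by blast

lemma simple_graph_finite: "simple_graph V E \<Longrightarrow> finite E"
  unfolding simple_graph_def by (auto intro: finite_subset[of E "Pow V"])

lemma simple_graph_card_le: "simple_graph V E \<Longrightarrow> card E \<le> 2 ^ card V"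
  unfolding simple_graph_def using card_mono[of "Pow V" E] by (auto simp: card_Pow)

text \<open>A kept edge counts 1 and a rejected one -1, which sums to
  \<open>2 * cut_size X' S - cut_size Y S\<close>. The error is measured against \<open>X\<close>,
  because it is in \<open>X\<close> that the edges of \<open>Y\<close> are heavy.\<close>

lemma half_sample_cuts:
  assumes X: "simple_graph V X" and "Y \<subseteq> X" and n: "2 \<le> card V"
    and heavy: "\<And>e S. e \<in> Y \<Longrightarrow> crosses S e \<Longrightarrow> k \<le> cut_size X S"
    and "0 < k" and \<delta>: "0 < \<delta>" "\<delta> \<le> 1" and k: "6 * ln (real (card V)) \<le> \<delta>\<^sup>2 / 4 * k"
  shows "measure_pmf.prob (half_sample Y)
      {X'. \<exists>S\<subseteq>V. \<bar>2 * cut_size X' S - cut_size Y S\<bar> > \<delta> * cut_size X S} \<le> 4 / (real (card V))\<^sup>2"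
proof -
  let ?M = "Pi_pmf Y False (\<lambda>_. bernoulli_pmf (1 / 2))"
  let ?f = "\<lambda>b. if b then 1 else (-1 :: real)"
  define dev where "dev \<omega> D = \<bar>\<Sum>e\<in>D. ?f (\<omega> e)\<bar>" for \<omega> and D :: "'a set set"
  have finX: "finite X" by (rule simple_graph_finite[OF X])
  then have finY: "finite Y" using \<open>Y \<subseteq> X\<close> finite_subset by blast
  have XV: "\<And>e. e \<in> X \<Longrightarrow> e \<subseteq> V \<and> card e = 2" using X by (simp add: simple_graph_def)
  have dev_eq: "dev \<omega> {e \<in> Y. crosses S e} = \<bar>2 * cut_size {e \<in> Y. \<omega> e} S - cut_size Y S\<bar>" for \<omega> S
  proof -
    have "(\<Sum>e\<in>{e \<in> Y. crosses S e}. ?f (\<omega> e)) =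
        (\<Sum>e\<in>{e \<in> Y. crosses S e}. 2 * (if \<omega> e then 1 else 0) - 1)"
      by (intro sum.cong) auto
    also have "\<dots> = 2 * (\<Sum>e\<in>{e \<in> Y. crosses S e}. if \<omega> e then 1 else 0) - cut_size Y S"
      by (simp add: sum_subtractf sum_distrib_left cut_size_def)
    also have "(\<Sum>e\<in>{e \<in> Y. crosses S e}. if \<omega> e then 1 else (0::real)) = cut_size {e \<in> Y. \<omega> e} S"
      using finY by (simp add: cut_size_def sum.inter_filter[symmetric] conj_ac)
    finally show ?thesis by (simp add: dev_def)
  qed
  have tail: "measure_pmf.prob ?M {\<omega>. dev \<omega> {e \<in> Y. crosses S e} > \<delta> * cut_val (\<lambda>_. 1) X S}
      \<le> 2 * exp (- (\<delta>\<^sup>2 / 4 * cut_val (\<lambda>_. 1) X S))" for S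
  proof -
    have "1 * real (card {e \<in> Y. crosses S e}) \<le> cut_size X S"
      using cut_size_mono[OF finX \<open>Y \<subseteq> X\<close>] by (simp add: cut_size_def)
    then show ?thesis
      using Pi_pmf_chernoff[OF finY, of "{e \<in> Y. crosses S e}" "bernoulli_pmf (1/2)" ?f 1 "cut_size X S" \<delta> False]
        bernoulli_half_mgf \<delta> unfolding dev_def cut_val_1 by simp
  qed
  have "measure_pmf.prob (half_sample Y)
      {X'. \<exists>S\<subseteq>V. \<bar>2 * cut_size X' S - cut_size Y S\<bar> > \<delta> * cut_size X S} =
    measure_pmf.prob ?M {\<omega>. \<exists>S\<subseteq>V. dev \<omega> {e \<in> Y. crosses S e} > \<delta> * cut_val (\<lambda>_. 1) X S}"
    unfolding half_sample_def dev_eq cut_val_1 measure_map_pmf by (simp add: vimage_def)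
  also have "\<dots> \<le> 4 / (real (card V))\<^sup>2"
  proof (rule cut_union_bound[where k = k and \<kappa> = "\<delta>\<^sup>2 / 4" and E = X])
    show "finite V" using X by (simp add: simple_graph_def)
    show "k \<le> cut_val (\<lambda>_. 1) X S" if "e \<in> Y" "crosses S e" for e S
      using heavy that by (simp add: cut_val_1)
    show "e \<subseteq> V \<and> card e = 2" if "e \<in> Y" for e using XV \<open>Y \<subseteq> X\<close> that by blast
    show "6 * ln (real (card V)) \<le> \<delta>\<^sup>2 / 4 * k" by (rule k)
    show "dev \<omega> {} = 0" for \<omega> by (simp add: dev_def)
  qed (use finX XV tail n \<open>0 < k\<close> \<delta> in simp_all)
  finally show ?thesis .
qed

text \<open>The decay makes the errors sum to at most 4 \<epsilon> / 13, and is slow enough for the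
  doubling threshold: squared error times threshold grows like \<open>(9 / 8)^j\<close>.\<close>

definition level_error :: "real \<Rightarrow> nat \<Rightarrow> real" where
  "level_error \<epsilon> j = \<epsilon> / 13 * (3 / 4) ^ j"

lemma level_error_pos: "0 < \<epsilon> \<Longrightarrow> 0 < level_error \<epsilon> j"
  by (simp add: level_error_def)

lemma level_error_le: "0 \<le> \<epsilon> \<Longrightarrow> level_error \<epsilon> j \<le> \<epsilon> / 13"
  unfolding level_error_def by (intro mult_left_le power_le_one) auto

text \<open>2668 is 1014 / 0.38 rounded down; the second bound follows from
  \<open>ln 2 >= 1 / 2\<close>.\<close>

lemma rho_ge:
  assumes "2 \<le> n" "0 < \<epsilon>" "\<epsilon> \<le> 1"
  shows "2668 * ln (real n) / \<epsilon>\<^sup>2 \<le> rho n \<epsilon>" "1 \<le> rho n \<epsilon>"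
proof -
  have ln: "1 / 2 \<le> ln (real n)"
  proof -
    have "exp (1 / 2) \<le> (2 :: real)" using exp_bound[of "1/2"] by (simp add: power2_eq_square)
    then have "1 / 2 \<le> ln (2 :: real)" by (intro ln_ge_iff[THEN iffD2]) simp_all
    also have "\<dots> \<le> ln (real n)" using assms by simp
    finally show ?thesis .
  qed
  have \<epsilon>: "0 < \<epsilon>\<^sup>2" "\<epsilon>\<^sup>2 \<le> 1" using assms by (auto simp: power_le_one)
  have "2668 * ln (real n) / \<epsilon>\<^sup>2 * (0.38 * \<epsilon>\<^sup>2) = 1013.84 * ln (real n)"
    using \<epsilon> by simp
  also have "\<dots> \<le> 1014 * ln (real n)" using ln by simp
  finally show 1: "2668 * ln (real n) / \<epsilon>\<^sup>2 \<le> rho n \<epsilon>"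
    unfolding rho_def using \<epsilon> by (subst pos_le_divide_eq) simp_all
  have "1 \<le> 2668 * ln (real n)" using ln by simp
  also have "\<dots> \<le> 2668 * ln (real n) / \<epsilon>\<^sup>2"
    using ln \<epsilon> by (simp add: le_divide_eq mult_left_le)
  finally show "1 \<le> rho n \<epsilon>" using 1 by simp
qed

lemma level_error_rho:
  assumes "2 \<le> n" "0 < \<epsilon>" "\<epsilon> \<le> 1"
  shows "6 * ln (real n) \<le> (level_error \<epsilon> j)\<^sup>2 / 4 * (rho n \<epsilon> * 2 ^ (j + 1))"
proof -
  have ln: "0 \<le> ln (real n)" using assms by simp
  \<comment> \<open>338 is 2 * 169: the squared error over 4, times the threshold, gives the factor
    2 / (4 * 169).\<close>
  have "6 * ln (real n) \<le> (2668 / 338) * ln (real n) * 1" using ln by simp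
  also have "\<dots> \<le> (2668 / 338) * ln (real n) * (9 / 8) ^ j"
    using ln by (intro mult_left_mono one_le_power) auto
  also have "\<dots> = (level_error \<epsilon> j)\<^sup>2 / 4 * ((2668 * ln (real n) / \<epsilon>\<^sup>2) * 2 ^ (j + 1))"
  proof -
    have "((3 / 4 :: real) ^ j)\<^sup>2 * 2 ^ j = (9 / 8) ^ j"
      by (simp add: power_mult_distrib[symmetric] power_mult[symmetric] mult.commute[of j] )
        (simp add: power_mult power_mult_distrib[symmetric] power2_eq_square)
    then show ?thesis
      using assms(2) unfolding level_error_def by (simp add: power_mult_distrib power_divide field_simps)
  qed
  also have "\<dots> \<le> (level_error \<epsilon> j)\<^sup>2 / 4 * (rho n \<epsilon> * 2 ^ (j + 1))"
    by (intro mult_left_mono mult_right_mono rho_ge(1)[OF assms]) auto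
  finally show ?thesis .
qed

text \<open>\<open>good_run V E \<epsilon> \<rho> i F X\<close>: \<open>X j\<close> and \<open>F j\<close> (\<open>j \<le> i\<close>) are the sets \<open>X\<^sub>j\<close>, \<open>F\<^sub>j\<close> of the algorithm, with
  \<open>Y\<^sub>j = X\<^sub>j - F\<^sub>j\<close>, and every halving step so far has nearly preserved all cuts.\<close>

definition good_run ::
    "'a set \<Rightarrow> 'a set set \<Rightarrow> real \<Rightarrow> real \<Rightarrow> nat \<Rightarrow> (nat \<Rightarrow> 'a set set) \<Rightarrow> (nat \<Rightarrow> 'a set set) \<Rightarrow> bool" where
  "good_run V E \<epsilon> \<rho> i F X \<longleftrightarrow> X 0 = E \<and> (\<forall>j\<le>i. F j \<subseteq> X j) \<and> (\<forall>j<i. X (Suc j) \<subseteq> X j - F j) \<and>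
     (\<forall>j\<le>i. \<forall>e\<in>X j - F j. \<forall>S. crosses S e \<longrightarrow> \<rho> * 2 ^ (j + 1) \<le> cut_size (X j) S) \<and>
     (\<forall>j<i. \<forall>S\<subseteq>V. \<bar>2 * cut_size (X (Suc j)) S - cut_size (X j - F j) S\<bar> \<le> level_error \<epsilon> j * cut_size (X j) S)"

lemma good_runD:
  assumes "good_run V E \<epsilon> \<rho> i F X"
  shows "X 0 = E" "\<And>j. j \<le> i \<Longrightarrow> F j \<subseteq> X j" "\<And>j. j < i \<Longrightarrow> X (Suc j) \<subseteq> X j - F j"
    "\<And>j e S. j \<le> i \<Longrightarrow> e \<in> X j - F j \<Longrightarrow> crosses S e \<Longrightarrow> \<rho> * 2 ^ (j + 1) \<le> cut_size (X j) S"
    "\<And>j S. j < i \<Longrightarrow> S \<subseteq> V \<Longrightarrow>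
      \<bar>2 * cut_size (X (Suc j)) S - cut_size (X j - F j) S\<bar> \<le> level_error \<epsilon> j * cut_size (X j) S"
proof -
  note r = assms[unfolded good_run_def]
  show "X 0 = E" using r by (rule conjunct1)
  show "F j \<subseteq> X j" if "j \<le> i" for j using r[THEN conjunct2, THEN conjunct1] that by simp
  show "X (Suc j) \<subseteq> X j - F j" if "j < i" for j
    using r[THEN conjunct2, THEN conjunct2, THEN conjunct1] that by simp
  show "\<rho> * 2 ^ (j + 1) \<le> cut_size (X j) S" if "j \<le> i" "e \<in> X j - F j" "crosses S e" for j e S
    using r[THEN conjunct2, THEN conjunct2, THEN conjunct2, THEN conjunct1] that by blast
  show "\<bar>2 * cut_size (X (Suc j)) S - cut_size (X j - F j) S\<bar> \<le> level_error \<epsilon> j * cut_size (X j) S"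
    if "j < i" "S \<subseteq> V" for j S
    using r[THEN conjunct2, THEN conjunct2, THEN conjunct2, THEN conjunct2] that by blast
qed

lemma good_run_subset:
  assumes "good_run V E \<epsilon> \<rho> i F X" "j \<le> i"
  shows "X j \<subseteq> E"
  using assms(2)
proof (induction j)
  case 0
  then show ?case using good_runD(1)[OF assms(1)] by simp
next
  case (Suc j)
  then show ?case using good_runD(3)[OF assms(1), of j] by auto
qed

lemma good_run_extend:
  assumes run: "good_run V E \<epsilon> \<rho> i F X" and "Z \<subseteq> X i - F i" "F' \<subseteq> Z"
    and heavy: "\<And>e S. e \<in> Z - F' \<Longrightarrow> crosses S e \<Longrightarrow> \<rho> * 2 ^ (Suc i + 1) \<le> cut_size Z S"
    and close: "\<And>S. S \<subseteq> V \<Longrightarrow> \<bar>2 * cut_size Z S - cut_size (X i - F i) S\<bar> \<le> level_error \<epsilon> i * cut_size (X i) S"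
  shows "good_run V E \<epsilon> \<rho> (Suc i) (F(Suc i := F')) (X(Suc i := Z))"
    (is "good_run V E \<epsilon> \<rho> (Suc i) ?F ?X")
  unfolding good_run_def
proof (intro conjI allI impI ballI)
  note D = good_runD[OF run]
  show "?X 0 = E" using D(1) by simp
  show "?F j \<subseteq> ?X j" if "j \<le> Suc i" for j
    using that D(2)[of j] assms(3) by (cases "j = Suc i") auto
  show "?X (Suc j) \<subseteq> ?X j - ?F j" if "j < Suc i" for j
    using that D(3)[of j] assms(2) by (cases "j = i") auto
  show "\<rho> * 2 ^ (j + 1) \<le> cut_size (?X j) S"
    if "j \<le> Suc i" "e \<in> ?X j - ?F j" "crosses S e" for j e S
    using that D(4)[of j e S] heavy[of e S] by (cases "j = Suc i") auto
  show "\<bar>2 * cut_size (?X (Suc j)) S - cut_size (?X j - ?F j) S\<bar> \<le> level_error \<epsilon> j * cut_size (?X j) S"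
    if "j < Suc i" "S \<subseteq> V" for j S
    using that D(5)[of j S] close[of S] by (cases "j = i") auto
qed

text \<open>Induction on the levels left, each costing at most \<open>4 / n^2\<close>. By level
  \<open>n\<close> the threshold exceeds the at most \<open>2^n\<close> edges, compression keeps all
  of them and \<open>Y\<close> is empty. \<open>F(0 := F0)\<close> puts the initial forests into
  slot 0, which the loop never writes.\<close>

lemma level_loop_good:
  assumes E: "simple_graph V E" and NI: "NI_procedure NI" and \<epsilon>: "0 < \<epsilon>" "\<epsilon> \<le> 1" and n: "2 \<le> card V"
    and \<rho>: "\<rho> = rho (card V) \<epsilon>"
    and run: "good_run V E \<epsilon> \<rho> i (F(0 := F0)) X" and "i \<le> card V"
    and "i = card V \<Longrightarrow> X i - (F(0 := F0)) i = {}"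
  shows "1 - real (card V - i) * (4 / (real (card V))\<^sup>2) \<le>
    measure (measure_spmf (level_loop NI V \<rho> i F (X i - (F(0 := F0)) i)))
      {(i', F', Y'). i' \<le> card V \<and> (\<exists>X'. good_run V E \<epsilon> \<rho> i' (F'(0 := F0)) X' \<and> Y' = X' i' - (F'(0 := F0)) i')}"
    (is "_ \<le> measure _ ?good")
  using run assms(8,9)
proof (induction "card V - i" arbitrary: i F X rule: less_induct)
  case less
  define Y where "Y = X i - (F(0 := F0)) i"
  let ?n = "card V"
  have \<rho>1: "1 \<le> \<rho>" unfolding \<rho> by (rule rho_ge(2)[OF n \<epsilon>])
  show ?case
  proof (cases "real (card Y) \<le> 2 * \<rho> * real ?n")
    case True
    have "(i, F, Y) \<in> ?good" using less.prems Y_def by auto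
    then have "measure (measure_spmf (level_loop NI V \<rho> i F Y)) ?good = 1"
      using True by (subst level_loop.simps) (simp add: measure_spmf_return_spmf measure_return)
    then show ?thesis unfolding Y_def[symmetric] by simp
  next
    case False
    \<comment> \<open>The loop goes on only with \<open>Y\<close> nonempty, which excludes
      \<open>i = card V\<close>.\<close>
    then have "Y \<noteq> {}" using \<rho>1 by auto
    then have i: "i < ?n" using less.prems Y_def by (metis le_neq_implies_less)
    have XE: "X i \<subseteq> E" using good_run_subset[OF less.prems(1)] by simp
    have Xi: "simple_graph V (X i)" by (rule simple_graph_subset[OF E XE])
    have "Y \<subseteq> X i" unfolding Y_def by auto
    define bad where "bad = {X'. \<exists>S\<subseteq>V. \<bar>2 * cut_size X' S - cut_size Y S\<bar> > level_error \<epsilon> i * cut_size (X i) S}"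
    have bad: "measure_pmf.prob (half_sample Y) bad \<le> 4 / (real ?n)\<^sup>2"
      unfolding bad_def
    proof (rule half_sample_cuts[OF Xi \<open>Y \<subseteq> X i\<close> n, where k = "\<rho> * 2 ^ (i + 1)"])
      show "\<rho> * 2 ^ (i + 1) \<le> cut_size (X i) S" if "e \<in> Y" "crosses S e" for e S
        using good_runD(4)[OF less.prems(1) order_refl] that unfolding Y_def by blast
      show "level_error \<epsilon> i \<le> 1" using level_error_le[of \<epsilon> i] \<epsilon> by simp
      show "6 * ln (real ?n) \<le> (level_error \<epsilon> i)\<^sup>2 / 4 * (\<rho> * 2 ^ (i + 1))"
        unfolding \<rho> by (rule level_error_rho[OF n \<epsilon>])
    qed (use \<rho>1 \<epsilon> level_error_pos in auto)
    have step: "1 - real (?n - Suc i) * (4 / (real ?n)\<^sup>2) \<le>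
        measure (measure_spmf (bind_spmf (contract_loop NI (\<rho> * 2 ^ (Suc i + 1)) (block_graph V Z))
          (\<lambda>H. level_loop NI V \<rho> (Suc i) (F(Suc i := edges H)) (Z - edges H)))) ?good"
      if Z: "Z \<in> set_pmf (half_sample Y)" "Z \<notin> bad" for Z
    proof -
      have "Z \<subseteq> Y" using Z(1) unfolding half_sample_def by auto
      then have Zg: "simple_graph V Z" using simple_graph_subset[OF Xi] \<open>Y \<subseteq> X i\<close> by blast
      have "0 \<le> \<rho> * 2 ^ (Suc i + 1)" using \<rho>1 by simp
      then obtain H where H: "contract_loop NI (\<rho> * 2 ^ (Suc i + 1)) (block_graph V Z) = return_spmf H"
        "edges H \<subseteq> Z"
        "\<And>e S. e \<in> Z - edges H \<Longrightarrow> crosses S e \<Longrightarrow> \<rho> * 2 ^ (Suc i + 1) \<le> real (card {f \<in> Z. crosses S f})"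
        "real (card Z) \<le> 2 * (\<rho> * 2 ^ (Suc i + 1)) * real (card V) \<Longrightarrow> edges H = Z"
        by (rule compress_level[OF Zg NI]) (rule that; blast)
      define F' where "F' = F(Suc i := edges H)"
      define X' where "X' = X(Suc i := Z)"
      have F': "F'(0 := F0) = (F(0 := F0))(Suc i := edges H)" unfolding F'_def by (simp add: fun_upd_twist)
      have run': "good_run V E \<epsilon> \<rho> (Suc i) (F'(0 := F0)) X'"
        unfolding F' X'_def
      proof (rule good_run_extend[OF less.prems(1)])
        show "Z \<subseteq> X i - (F(0 := F0)) i" using \<open>Z \<subseteq> Y\<close> unfolding Y_def .
        show "\<bar>2 * cut_size Z S - cut_size (X i - (F(0 := F0)) i) S\<bar> \<le> level_error \<epsilon> i * cut_size (X i) S"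
          if "S \<subseteq> V" for S
          using Z(2) that unfolding bad_def Y_def[symmetric] by (simp add: not_less)
      qed (use H in \<open>auto simp: cut_size_def\<close>)
      have last: "X' (Suc i) - (F'(0 := F0)) (Suc i) = {}" if "Suc i = ?n"
      proof -
        have "real (card Z) \<le> 2 ^ ?n" using simple_graph_card_le[OF Zg] by (metis of_nat_le_iff of_nat_numeral of_nat_power)
        also have "\<dots> \<le> 2 * (\<rho> * 2 ^ (Suc i + 1)) * real ?n"
        proof -
          have "1 * 1 \<le> 4 * \<rho> * real ?n" using \<rho>1 n by (intro mult_mono) auto
          then show ?thesis unfolding that using mult_right_mono[of 1 "4 * \<rho> * real ?n" "2 ^ ?n"] by simp
        qed
        finally show ?thesis using H(4) unfolding X'_def F'_def by simp
      qed
      have "1 - real (?n - Suc i) * (4 / (real ?n)\<^sup>2) \<le>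
        measure (measure_spmf (level_loop NI V \<rho> (Suc i) F' (X' (Suc i) - (F'(0 := F0)) (Suc i)))) ?good"
        by (rule less.hyps) (use i run' last in auto)
      then show ?thesis unfolding H(1) X'_def F'_def by simp
    qed
    have "1 - (4 / (real ?n)\<^sup>2 + real (?n - Suc i) * (4 / (real ?n)\<^sup>2)) \<le>
        measure (measure_spmf (level_loop NI V \<rho> i F Y)) ?good"
      by (subst level_loop.simps)
        (use False spmf_prob_bind_pmf_ge[OF bad _ step] in simp)
    moreover have "real (?n - i) = 1 + real (?n - Suc i)" using i by (simp add: of_nat_diff)
    ultimately show ?thesis unfolding Y_def[symmetric] by (simp only: distrib_right mult_1_left)
  qed
qed


section \<open>Resampling\<close>

text \<open>The two-stage bound with divergence counted as failure: \<open>None\<close> belongs to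
  the bad event of the first stage.\<close>

lemma spmf_prob_bind_ge:
  assumes "1 - q \<le> measure (measure_spmf p) C" "0 \<le> r"
    and f: "\<And>x. x \<in> C \<Longrightarrow> 1 - r \<le> measure (measure_spmf (f x)) A"
  shows "1 - (q + r) \<le> measure (measure_spmf (bind_spmf p f)) A"
proof -
  have "measure_pmf.prob p (- Some ` C) \<le> q"
    using assms(1) measure_pmf.prob_compl[of "Some ` C" p]
    by (simp add: measure_measure_spmf_conv_measure_pmf Compl_eq_Diff_UNIV)
  then have "1 - (q + r) \<le> measure_pmf.prob
      (bind_pmf p (\<lambda>a. case a of None \<Rightarrow> return_pmf None | Some x \<Rightarrow> f x)) (Some ` A)"
    by (rule prob_bind_pmf_ge)
      (use assms(2) f in \<open>auto simp: measure_measure_spmf_conv_measure_pmf\<close>)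
  then show ?thesis by (simp add: measure_measure_spmf_conv_measure_pmf bind_spmf_def)
qed

text \<open>Division by \<open>p\<close> gives each edge the mean \<open>N\<close>. The
  exponential-moment parameter \<open>N * p\<close> per edge adds up to at most
  \<open>p * cut_val q E S\<close> by \<open>dom\<close>, so the union bound applies with \<kappa> =
  \<open>\<eta>^2 * p / 4\<close>.\<close>

lemma binomial_sample_cuts:
  fixes q :: "'a set \<Rightarrow> real"
  assumes E: "simple_graph V E" and "R \<subseteq> E" and n: "2 \<le> card V" and q: "\<And>e. e \<in> E \<Longrightarrow> 0 \<le> q e"
    and dom: "\<And>S. real N * cut_size R S \<le> cut_val q E S"
    and heavy: "\<And>e S. e \<in> R \<Longrightarrow> S \<subseteq> V \<Longrightarrow> crosses S e \<Longrightarrow> k \<le> cut_val q E S"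
    and "0 < k" and p: "0 < p" "p \<le> 1" and \<eta>: "0 < \<eta>" "\<eta> \<le> 1"
    and k: "6 * ln (real (card V)) \<le> \<eta>\<^sup>2 * p / 4 * k"
  shows "measure_pmf.prob (Pi_pmf R 0 (\<lambda>_. binomial_pmf N p))
      {r. \<exists>S\<subseteq>V. \<bar>(\<Sum>e | e \<in> R \<and> crosses S e. real (r e) / p) - real N * cut_size R S\<bar> > \<eta> * cut_val q E S}
      \<le> 4 / (real (card V))\<^sup>2"
proof -
  let ?M = "Pi_pmf R 0 (\<lambda>_. binomial_pmf N p)"
  let ?f = "\<lambda>r. real r - real N * p"
  define dev where "dev r D = \<bar>\<Sum>e\<in>D. ?f (r e)\<bar> / p" for r and D :: "'a set set"
  have finE: "finite E" by (rule simple_graph_finite[OF E])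
  then have finR: "finite R" using \<open>R \<subseteq> E\<close> finite_subset by blast
  have EV: "\<And>e. e \<in> E \<Longrightarrow> e \<subseteq> V \<and> card e = 2" using E by (simp add: simple_graph_def)
  have dev_eq: "dev r {e \<in> R. crosses S e} =
      \<bar>(\<Sum>e | e \<in> R \<and> crosses S e. real (r e) / p) - real N * cut_size R S\<bar>" for r S
  proof -
    have "(\<Sum>e | e \<in> R \<and> crosses S e. real (r e) / p) - real N * cut_size R S =
        (\<Sum>e | e \<in> R \<and> crosses S e. ?f (r e)) / p"
      using p by (simp add: cut_size_def sum_subtractf sum_divide_distrib[symmetric] diff_divide_distrib)
    then show ?thesis using p by (simp add: dev_def)
  qed
  have tail: "measure_pmf.prob ?M {r. dev r {e \<in> R. crosses S e} > \<eta> * cut_val q E S}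
      \<le> 2 * exp (- (\<eta>\<^sup>2 * p / 4 * cut_val q E S))" for S
  proof -
    have "real N * p * real (card {e \<in> R. crosses S e}) \<le> p * cut_val q E S"
      using mult_left_mono[OF dom[of S], of p] p by (simp add: cut_size_def mult_ac)
    then have "measure_pmf.prob ?M {r. \<bar>\<Sum>e\<in>{e \<in> R. crosses S e}. ?f (r e)\<bar> > \<eta> * (p * cut_val q E S)}
        \<le> 2 * exp (- (\<eta>\<^sup>2 * (p * cut_val q E S) / 4))"
      using Pi_pmf_chernoff[OF finR, of "{e \<in> R. crosses S e}" "binomial_pmf N p" ?f "real N * p"]
        binomial_mgf[of p] p \<eta> by fastforce
    also have "{r. \<bar>\<Sum>e\<in>{e \<in> R. crosses S e}. ?f (r e)\<bar> > \<eta> * (p * cut_val q E S)} =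
        {r. dev r {e \<in> R. crosses S e} > \<eta> * cut_val q E S}"
      using p by (simp add: dev_def less_divide_eq mult_ac)
    finally show ?thesis by (simp add: mult_ac)
  qed
  have "measure_pmf.prob ?M {r. \<exists>S\<subseteq>V. dev r {e \<in> R. crosses S e} > \<eta> * cut_val q E S}
      \<le> 4 / (real (card V))\<^sup>2"
  proof (rule cut_union_bound[where k = k and \<kappa> = "\<eta>\<^sup>2 * p / 4" and E = E])
    show "finite V" using E by (simp add: simple_graph_def)
    show "e \<subseteq> V \<and> card e = 2" if "e \<in> R" for e using EV \<open>R \<subseteq> E\<close> that by blast
    show "6 * ln (real (card V)) \<le> \<eta>\<^sup>2 * p / 4 * k" by (rule k)
    show "dev r {} = 0" for r by (simp add: dev_def)
  qed (use finE EV tail n \<open>0 < k\<close> \<eta> q heavy in simp_all)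
  then show ?thesis unfolding dev_eq .
qed

lemma cut_weight_update:
  assumes "finite (dom W)" "finite F" "dom W \<inter> F = {}"
  shows "cut_weight (\<lambda>e. if e \<in> F \<and> 0 < r e then Some (real (r e) / p) else W e) S =
    cut_weight W S + (\<Sum>e | e \<in> F \<and> crosses S e. real (r e) / p)"
    (is "cut_weight ?W' S = _")
proof -
  have "{e \<in> dom ?W'. crosses S e} = {e \<in> dom W. crosses S e} \<union> {e \<in> F. 0 < r e \<and> crosses S e}"
    using assms(3) by (auto simp: dom_def)
  then have "cut_weight ?W' S =
      (\<Sum>e\<in>{e \<in> dom W. crosses S e} \<union> {e \<in> F. 0 < r e \<and> crosses S e}. the (?W' e))"
    unfolding cut_weight_def by simp
  also have "\<dots> = (\<Sum>e | e \<in> dom W \<and> crosses S e. the (?W' e)) +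
      (\<Sum>e | e \<in> F \<and> 0 < r e \<and> crosses S e. the (?W' e))"
    by (rule sum.union_disjoint) (use assms in auto)
  also have "(\<Sum>e | e \<in> dom W \<and> crosses S e. the (?W' e)) = cut_weight W S"
    unfolding cut_weight_def by (rule sum.cong) (use assms(3) in auto)
  also have "(\<Sum>e | e \<in> F \<and> 0 < r e \<and> crosses S e. the (?W' e)) =
      (\<Sum>e | e \<in> F \<and> crosses S e. real (r e) / p)"
    by (rule sum.mono_neutral_cong_left) (use assms(2) in auto)
  finally show ?thesis .
qed

text \<open>Levels are resampled from the top down on disjoint edge sets, so their cut weights
  simply add, and so do the failure probabilities. \<open>T j S\<close> is the tolerance for level
  \<open>Suc j\<close>.\<close>

lemma resample_cuts:
  assumes fin: "finite (dom W)" "\<And>j. j < i \<Longrightarrow> finite (F (Suc j))"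
    and disj: "\<And>j l. j < l \<Longrightarrow> l < i \<Longrightarrow> F (Suc j) \<inter> F (Suc l) = {}"
    and dom: "\<And>j. j < i \<Longrightarrow> dom W \<inter> F (Suc j) = {}"
    and tail: "\<And>j. j < i \<Longrightarrow> measure_pmf.prob
        (Pi_pmf (F (Suc j)) 0 (\<lambda>_. binomial_pmf (2 ^ Suc j) (level_prob (Suc j))))
        {r. \<exists>S\<subseteq>V. \<bar>(\<Sum>e | e \<in> F (Suc j) \<and> crosses S e. real (r e) / level_prob (Suc j)) -
          2 ^ Suc j * cut_size (F (Suc j)) S\<bar> > T j S} \<le> q"
    and "0 \<le> q"
  shows "1 - real i * q \<le> measure_pmf.prob (resample F i W)
    {G. \<forall>S\<subseteq>V. \<bar>cut_weight G S - (cut_weight W S + (\<Sum>j<i. 2 ^ Suc j * cut_size (F (Suc j)) S))\<bar> \<le> (\<Sum>j<i. T j S)}"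
  using fin disj dom tail
proof (induction i arbitrary: W)
  case 0
  then show ?case by simp
next
  case (Suc i)
  let ?p = "level_prob (Suc i)"
  let ?W' = "\<lambda>r e. if e \<in> F (Suc i) \<and> 0 < r e then Some (real (r e) / ?p) else W e"
  let ?B = "{r. \<exists>S\<subseteq>V. \<bar>(\<Sum>e | e \<in> F (Suc i) \<and> crosses S e. real (r e) / ?p) -
          2 ^ Suc i * cut_size (F (Suc i)) S\<bar> > T i S}"
  let ?A = "{G. \<forall>S\<subseteq>V. \<bar>cut_weight G S - (cut_weight W S + (\<Sum>j<Suc i. 2 ^ Suc j * cut_size (F (Suc j)) S))\<bar>
      \<le> (\<Sum>j<Suc i. T j S)}"
  have "1 - real i * q \<le> measure_pmf.prob (resample F i (?W' r)) ?A" if r: "r \<notin> ?B" for r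
  proof -
    have domW': "dom (?W' r) \<subseteq> dom W \<union> F (Suc i)" by (auto simp: dom_def)
    have upd: "cut_weight (?W' r) S = cut_weight W S + (\<Sum>e | e \<in> F (Suc i) \<and> crosses S e. real (r e) / ?p)" for S
      by (rule cut_weight_update) (use Suc.prems in auto)
    have "1 - real i * q \<le> measure_pmf.prob (resample F i (?W' r))
      {G. \<forall>S\<subseteq>V. \<bar>cut_weight G S - (cut_weight (?W' r) S + (\<Sum>j<i. 2 ^ Suc j * cut_size (F (Suc j)) S))\<bar>
        \<le> (\<Sum>j<i. T j S)}"
    proof (rule Suc.IH)
      show "finite (dom (?W' r))" using finite_subset[OF domW'] Suc.prems(1,2) by simp
      show "dom (?W' r) \<inter> F (Suc j) = {}" if "j < i" for j
        using domW' Suc.prems(3)[of j i] Suc.prems(4)[of j] that by fastforce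
    qed (use Suc.prems in auto)
    also have "\<dots> \<le> measure_pmf.prob (resample F i (?W' r)) ?A"
    proof (rule measure_pmf.finite_measure_mono; safe?)
      fix G S
      assume *: "\<forall>S\<subseteq>V. \<bar>cut_weight G S - (cut_weight (?W' r) S + (\<Sum>j<i. 2 ^ Suc j * cut_size (F (Suc j)) S))\<bar>
        \<le> (\<Sum>j<i. T j S)" and S: "S \<subseteq> V"
      have "\<bar>(\<Sum>e | e \<in> F (Suc i) \<and> crosses S e. real (r e) / ?p) - 2 ^ Suc i * cut_size (F (Suc i)) S\<bar> \<le> T i S"
        using r S by (simp add: not_less)
      with *[rule_format, OF S]
      show "\<bar>cut_weight G S - (cut_weight W S + (\<Sum>j<Suc i. 2 ^ Suc j * cut_size (F (Suc j)) S))\<bar>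
        \<le> (\<Sum>j<Suc i. T j S)"
        unfolding upd sum.lessThan_Suc by linarith
    qed simp
    finally show ?thesis .
  qed
  then have "1 - (q + real i * q) \<le> measure_pmf.prob (resample F (Suc i) W) ?A"
    unfolding resample.simps
    by (intro prob_bind_pmf_ge[where B = ?B] Suc.prems(5)) (use \<open>0 \<le> q\<close> in auto)
  then show ?case by (simp add: algebra_simps)
qed

text \<open>At level \<open>i\<close> the fraction is \<open>(1536 / 169) / 4^i\<close>, and 1536 /
  169 exceeds 4; where the minimum is 1, already \<open>4^i >= 4\<close>.\<close>

lemma level_prob_bounds: "0 < level_prob (Suc j)" "level_prob (Suc j) \<le> 1" "4 \<le> level_prob (Suc j) * 4 ^ Suc j"
proof -
  have "(2::real) powi (2 * int (Suc j)) = 4 ^ Suc j"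
  proof -
    have "2 * int (Suc j) = int (2 * Suc j)" by simp
    then have "(2::real) powi (2 * int (Suc j)) = 2 ^ (2 * Suc j)" by (simp only: power_int_of_nat)
    also have "\<dots> = 4 ^ Suc j" unfolding power_mult by simp
    finally show ?thesis .
  qed
  then have "(2::real) powi (2 * int (Suc j) - 9) = 4 ^ Suc j / 512"
    by (subst power_int_diff) simp_all
  then have eq: "level_prob (Suc j) = min (1536 / 169 / 4 ^ Suc j) 1"
    by (simp only: level_prob_def) simp
  show "0 < level_prob (Suc j)" "level_prob (Suc j) \<le> 1" unfolding eq by simp_all
  have "(1::real) \<le> 4 ^ j" by simp
  then show "4 \<le> level_prob (Suc j) * 4 ^ Suc j" unfolding eq min_def by simp
qed

text \<open>The graphs against which the resampling error of level \<open>Suc j\<close> is measured: the edges of the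
  levels \<open>l > j\<close>, which have weight \<open>2\<^sup>l\<close>, are scaled down by \<open>4\<^bsup>l - Suc j\<^esup>\<close>.  A cut whose highest level is
  \<open>l\<close> has weight about \<open>\<rho> 4\<^sup>l\<close>, so the scaling preserves the heaviness of level \<open>Suc j\<close>, while the sum
  over all \<open>j\<close> stays within a constant factor of the unscaled graph.\<close>

definition scaled_weight :: "nat \<Rightarrow> nat \<Rightarrow> real" where
  "scaled_weight j l = (if l = j then 2 ^ j else 4 ^ Suc j / 2 ^ l)"

lemma scaled_weight_nonneg: "0 \<le> scaled_weight j l"
  by (simp add: scaled_weight_def)

text \<open>The top level is \<open>X i\<close> rather than \<open>F i\<close>, because the
  remaining edges \<open>X i - F i\<close> enter the output with the same weight
  \<open>2 ^ i\<close>.\<close>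

definition level_edges :: "nat \<Rightarrow> (nat \<Rightarrow> 'a set set) \<Rightarrow> (nat \<Rightarrow> 'a set set) \<Rightarrow> nat \<Rightarrow> 'a set set" where
  "level_edges i F X l = (if l < i then F l else X i)"

lemma cut_val_levels:
  assumes "finite E" "finite L" "\<And>l. l \<in> L \<Longrightarrow> A l \<subseteq> E"
  shows "cut_val (\<lambda>e. \<Sum>l\<in>L. if e \<in> A l then w l else 0) E S = (\<Sum>l\<in>L. w l * cut_size (A l) S)"
proof -
  have "cut_val (\<lambda>e. \<Sum>l\<in>L. if e \<in> A l then w l else 0) E S =
      (\<Sum>l\<in>L. \<Sum>e | e \<in> E \<and> crosses S e. if e \<in> A l then w l else 0)"
    unfolding cut_val_def by (rule sum.swap)
  also have "\<dots> = (\<Sum>l\<in>L. w l * cut_size (A l) S)"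
  proof (rule sum.cong[OF refl])
    fix l assume "l \<in> L"
    then have "{e \<in> {e \<in> E. crosses S e}. e \<in> A l} = {e \<in> A l. crosses S e}" using assms(3) by auto
    then show "(\<Sum>e | e \<in> E \<and> crosses S e. if e \<in> A l then w l else 0) = w l * cut_size (A l) S"
      using assms(1) by (simp add: sum.inter_filter[symmetric] cut_size_def)
  qed
  finally show ?thesis .
qed

text \<open>The index \<open>j = l\<close> contributes \<open>2 ^ l\<close>; the smaller ones form a
  geometric sum below \<open>4 / 3 * 2 ^ l\<close>.\<close>

lemma sum_scaled_weight_le:
  assumes "l \<le> i"
  shows "(\<Sum>j<i. if j \<le> l then scaled_weight j l else 0) \<le> 7 / 3 * 2 ^ l"
proof -
  have "(\<Sum>j<i. if j \<le> l then scaled_weight j l else 0) = (\<Sum>j | j < i \<and> j \<le> l. scaled_weight j l)"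
    by (simp add: sum.inter_filter[symmetric] lessThan_def)
  also have "\<dots> \<le> (\<Sum>j<Suc l. scaled_weight j l)"
    by (rule sum_mono2) (auto intro: scaled_weight_nonneg)
  also have "\<dots> = (\<Sum>j<l. 4 ^ Suc j / 2 ^ l) + 2 ^ l"
    by (simp add: scaled_weight_def)
  also have "(\<Sum>j<l. 4 ^ Suc j / 2 ^ l) = 4 * (\<Sum>j<l. 4 ^ j) / (2 ^ l :: real)"
    by (simp add: sum_divide_distrib sum_distrib_left)
  also have "(\<Sum>j<l. 4 ^ j) = ((4::real) ^ l - 1) / 3"
    by (simp add: sum_gp_strict field_simps)
  also have "4 * ((4 ^ l - 1) / 3) / 2 ^ l + 2 ^ l \<le> (7 / 3 * 2 ^ l :: real)"
  proof -
    have "(4::real) ^ l = 2 ^ l * 2 ^ l" by (simp flip: power_mult_distrib)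
    then show ?thesis by (simp add: field_simps)
  qed
  finally show ?thesis .
qed

lemma sum_level_error_le: "0 \<le> \<epsilon> \<Longrightarrow> (\<Sum>j<i. level_error \<epsilon> j) \<le> 4 * \<epsilon> / 13"
proof -
  assume "0 \<le> \<epsilon>"
  have "(\<Sum>j<i. (3 / 4 :: real) ^ j) \<le> 4" by (simp add: sum_gp_strict)
  then have "\<epsilon> / 13 * (\<Sum>j<i. (3 / 4) ^ j) \<le> \<epsilon> / 13 * 4"
    using \<open>0 \<le> \<epsilon>\<close> by (intro mult_left_mono) auto
  then show ?thesis by (simp add: level_error_def sum_distrib_left mult_ac)
qed

text \<open>Interpolates between \<open>G\<close> at \<open>j = 0\<close> and the compressed graph
  at \<open>j = i\<close>: levels below \<open>j\<close> are settled, and \<open>X j\<close> stands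
  for the rest.\<close>

definition compressed_cut ::
    "(nat \<Rightarrow> 'a set set) \<Rightarrow> (nat \<Rightarrow> 'a set set) \<Rightarrow> nat \<Rightarrow> 'a set \<Rightarrow> real" where
  "compressed_cut F X j S = (\<Sum>l<j. 2 ^ l * cut_size (F l) S) + 2 ^ j * cut_size (X j) S"

text \<open>The cut weight in the reference graph for level \<open>Suc j\<close>. The sum starts one
  level lower, as heaviness may have to draw on \<open>F j\<close>.\<close>

definition scaled_cut ::
    "nat \<Rightarrow> (nat \<Rightarrow> 'a set set) \<Rightarrow> (nat \<Rightarrow> 'a set set) \<Rightarrow> nat \<Rightarrow> 'a set \<Rightarrow> real" where
  "scaled_cut i F X j S = (\<Sum>l\<in>{j..i}. scaled_weight j l * cut_size (level_edges i F X l) S)"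

section \<open>Cut weights along a good run\<close>

context
  fixes V :: "'a set" and E \<epsilon> \<rho> i F X
  assumes E: "simple_graph V E" and \<epsilon>: "0 < \<epsilon>" "\<epsilon> \<le> 1"
    and run: "good_run V E \<epsilon> \<rho> i F X"
begin

lemma run_finite: "j \<le> i \<Longrightarrow> finite (X j)"
  using good_run_subset[OF run] simple_graph_finite[OF E] finite_subset by blast

lemma run_split: "j \<le> i \<Longrightarrow> cut_size (X j) S = cut_size (F j) S + cut_size (X j - F j) S"
  by (rule cut_size_split[OF run_finite good_runD(2)[OF run]])

lemma run_decreasing: "j < l \<Longrightarrow> l \<le> i \<Longrightarrow> X l \<subseteq> X j - F j"
proof (induction l)
  case (Suc l)
  then show ?case using good_runD(3)[OF run, of l] by (cases "j = l") auto
qed simp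

lemma level_edges_subset: "l \<le> i \<Longrightarrow> level_edges i F X l \<subseteq> X l"
  unfolding level_edges_def using good_runD(2)[OF run, of l] by (cases "l = i") simp_all

text \<open>Each halving alters a cut by at most \<open>level_error \<epsilon> j\<close> times its
  current weight, of which \<open>2 ^ j * cut_size (X j) S\<close> is a part. That weight stays
  below 3 / 2 of the original one, since 3 / 2 times the sum of all errors is at most 6 /
  13.\<close>

lemma compressed_cut_close:
  assumes S: "S \<subseteq> V" and "j \<le> i"
  shows "\<bar>compressed_cut F X j S - cut_size E S\<bar> \<le> 3 / 2 * (\<Sum>l<j. level_error \<epsilon> l) * cut_size E S"
  using assms(2)
proof (induction j)
  case 0
  then show ?case using good_runD(1)[OF run] by (simp add: compressed_cut_def)
next
  case (Suc j)
  let ?G = "cut_size E S"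
  let ?s = "\<Sum>l<j. level_error \<epsilon> l"
  have err: "0 \<le> level_error \<epsilon> j" using level_error_pos[OF \<epsilon>(1)] by (simp add: less_imp_le)
  have IH: "\<bar>compressed_cut F X j S - ?G\<bar> \<le> 3 / 2 * ?s * ?G" using Suc by simp
  have "3 / 2 * ?s \<le> 1 / 2" using sum_level_error_le[of \<epsilon> j] \<epsilon> by simp
  then have "3 / 2 * ?s * ?G \<le> 1 / 2 * ?G" by (intro mult_right_mono cut_size_nonneg)
  then have cc: "compressed_cut F X j S \<le> 3 / 2 * ?G" using IH by linarith
  \<comment> \<open>The contributions of \<open>F j\<close> cancel, leaving the halving error
    alone.\<close>
  have "compressed_cut F X (Suc j) S - compressed_cut F X j S =
      2 ^ j * (2 * cut_size (X (Suc j)) S - cut_size (X j - F j) S)"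
    using run_split[of j S] Suc.prems by (simp add: compressed_cut_def algebra_simps)
  then have "\<bar>compressed_cut F X (Suc j) S - compressed_cut F X j S\<bar> \<le> 2 ^ j * (level_error \<epsilon> j * cut_size (X j) S)"
    using good_runD(5)[OF run _ S, of j] Suc.prems by (simp add: abs_mult)
  also have "\<dots> = level_error \<epsilon> j * (2 ^ j * cut_size (X j) S)" by simp
  also have "\<dots> \<le> level_error \<epsilon> j * compressed_cut F X j S"
    by (intro mult_left_mono err) (auto simp: compressed_cut_def intro!: sum_nonneg mult_nonneg_nonneg cut_size_nonneg)
  also have "\<dots> \<le> level_error \<epsilon> j * (3 / 2 * ?G)"
    by (intro mult_left_mono err cc)
  finally have "\<bar>compressed_cut F X (Suc j) S - compressed_cut F X j S\<bar> \<le> level_error \<epsilon> j * (3 / 2 * ?G)" .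
  moreover have "3 / 2 * (\<Sum>l<Suc j. level_error \<epsilon> l) * ?G = 3 / 2 * ?s * ?G + level_error \<epsilon> j * (3 / 2 * ?G)"
    by (simp add: algebra_simps)
  ultimately show ?case using IH by linarith
qed

lemma compressed_cut_levels:
  "compressed_cut F X i S = (\<Sum>l\<le>i. 2 ^ l * cut_size (level_edges i F X l) S)"
  by (simp add: compressed_cut_def level_edges_def lessThan_Suc_atMost[symmetric])

lemma sum_scaled_cut_le: "(\<Sum>j<i. scaled_cut i F X j S) \<le> 7 / 3 * compressed_cut F X i S"
proof -
  have "(\<Sum>j<i. scaled_cut i F X j S) =
      (\<Sum>j<i. \<Sum>l\<le>i. (if j \<le> l then scaled_weight j l else 0) * cut_size (level_edges i F X l) S)"
    unfolding scaled_cut_def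
    by (intro sum.cong refl sum.mono_neutral_cong_left) auto
  also have "\<dots> = (\<Sum>l\<le>i. (\<Sum>j<i. if j \<le> l then scaled_weight j l else 0) * cut_size (level_edges i F X l) S)"
    unfolding sum_distrib_right by (rule sum.swap)
  also have "\<dots> \<le> (\<Sum>l\<le>i. (7 / 3 * 2 ^ l) * cut_size (level_edges i F X l) S)"
    by (intro sum_mono mult_right_mono sum_scaled_weight_le cut_size_nonneg) auto
  also have "\<dots> = 7 / 3 * compressed_cut F X i S"
    by (simp add: compressed_cut_levels sum_distrib_left mult_ac)
  finally show ?thesis .
qed

text \<open>Let \<open>l\<close> be the highest level at which \<open>S\<close> is crossed, and
  \<open>l' = l - 1\<close>. An edge of \<open>X l\<close> was dropped by the compression of
  \<open>X l'\<close>, so \<open>S\<close> has at least \<open>\<rho> * 2^l\<close> edges in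
  \<open>X l'\<close>; up to the halving error they are accounted for by \<open>F l'\<close> and
  twice \<open>X l\<close>. Almost all of \<open>X l\<close> in turn lies in the edges of level
  \<open>l\<close>. The two losses of 12 / 13 give 144 / 169, which the scaling halves.\<close>

lemma scaled_cut_heavy:
  assumes j: "Suc j \<le> i" and S: "S \<subseteq> V" and e: "e \<in> F (Suc j)" "crosses S e" and "0 \<le> \<rho>"
  shows "72 / 169 * \<rho> * 4 ^ Suc j \<le> scaled_cut i F X j S"
proof -
  let ?A = "level_edges i F X"
  define P where "P = {l \<in> {Suc j..i}. \<exists>f\<in>X l. crosses S f}"
  have "Suc j \<in> P" using j e good_runD(2)[OF run j] by (auto simp: P_def)
  then have P: "finite P" "P \<noteq> {}" by (auto simp: P_def)
  define l where "l = Max P"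
  have "l \<in> P" unfolding l_def by (rule Max_in[OF P])
  then obtain l' f where l: "l = Suc l'" "j \<le> l'" "l \<le> i" and f: "f \<in> X l" "crosses S f"
    by (cases l) (auto simp: P_def)
  have err: "level_error \<epsilon> k * cut_size Z S \<le> 1 / 13 * cut_size Z S" for k and Z :: "'a set set"
    using level_error_le[of \<epsilon> k] \<epsilon> by (intro mult_right_mono cut_size_nonneg) auto
  have "f \<in> X l' - F l'" using run_decreasing[of l' l] l f by auto
  then have "\<rho> * 2 ^ l \<le> cut_size (X l') S"
    using good_runD(4)[OF run _ _ f(2), of l'] l by simp
  moreover have "\<bar>2 * cut_size (X l) S - cut_size (X l' - F l') S\<bar> \<le> 1 / 13 * cut_size (X l') S"
    using good_runD(5)[OF run _ S, of l'] err[of l' "X l'"] l by simp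
  moreover have "cut_size (X l') S = cut_size (F l') S + cut_size (X l' - F l') S"
    using run_split l by simp
  ultimately have lower: "12 / 13 * (\<rho> * 2 ^ l) \<le> 2 * cut_size (X l) S + cut_size (F l') S" by linarith
  \<comment> \<open>Below the top, no edge of \<open>X (Suc l)\<close> crosses \<open>S\<close>, so
    the halving bound leaves at most a 13th of \<open>X l\<close> outside
    \<open>F l\<close>.\<close>
  have A_l: "12 / 13 * cut_size (X l) S \<le> cut_size (?A l) S"
  proof (cases "l = i")
    case True
    then show ?thesis using cut_size_nonneg[of "X l" S] by (simp add: level_edges_def)
  next
    case False
    then have li: "Suc l \<le> i" using l by simp
    have "Suc l \<notin> P" using Max_ge[OF P(1), of "Suc l"] by (auto simp: l_def)
    then have "{f \<in> X (Suc l). crosses S f} = {}" using li l by (auto simp: P_def)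
    then have "cut_size (X (Suc l)) S = 0" by (simp only: cut_size_def card.empty of_nat_0)
    then have "cut_size (X l - F l) S \<le> 1 / 13 * cut_size (X l) S"
      using good_runD(5)[OF run _ S, of l] err[of l "X l"] li by simp
    then show ?thesis using run_split[of l S] l False by (simp add: level_edges_def)
  qed
  have A_l': "?A l' = F l'" using l by (simp add: level_edges_def)
  have "144 / 169 * (\<rho> * 2 ^ l) \<le> 12 / 13 * (2 * cut_size (X l) S + cut_size (F l') S)"
    using lower by simp
  also have "\<dots> \<le> 2 * cut_size (?A l) S + cut_size (?A l') S"
    using A_l cut_size_nonneg[of "F l'" S] by (simp add: A_l')
  finally have AA: "144 / 169 * (\<rho> * 2 ^ l) \<le> 2 * cut_size (?A l) S + cut_size (?A l') S" .
  have w: "scaled_weight j l = 2 * (4 ^ Suc j / 2 ^ Suc l)"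
    using l by (simp add: scaled_weight_def)
  \<comment> \<open>For \<open>l' = j\<close> both sides equal \<open>2 ^ j\<close>: the special
    weight of level \<open>j\<close> just suffices.\<close>
  have w': "4 ^ Suc j / 2 ^ Suc l \<le> scaled_weight j l'"
  proof (cases "l' = j")
    case True
    have "(4::real) ^ j = 2 ^ j * 2 ^ j" by (simp flip: power_mult_distrib)
    then show ?thesis using True l by (simp add: scaled_weight_def)
  next
    case False
    have "(4::real) ^ Suc j / 2 ^ Suc l \<le> 4 ^ Suc j / 2 ^ l'"
      by (intro divide_left_mono power_increasing) (auto simp: l)
    then show ?thesis using False by (simp add: scaled_weight_def)
  qed
  have "72 / 169 * \<rho> * 4 ^ Suc j = 4 ^ Suc j / 2 ^ Suc l * (144 / 169 * (\<rho> * 2 ^ l))" by simp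
  also have "\<dots> \<le> 4 ^ Suc j / 2 ^ Suc l * (2 * cut_size (?A l) S + cut_size (?A l') S)"
    by (intro mult_left_mono AA) simp
  also have "\<dots> = scaled_weight j l * cut_size (?A l) S + 4 ^ Suc j / 2 ^ Suc l * cut_size (?A l') S"
    unfolding w by (simp only: distrib_left mult_ac)
  also have "\<dots> \<le> scaled_weight j l * cut_size (?A l) S + scaled_weight j l' * cut_size (?A l') S"
    by (intro add_left_mono mult_right_mono w' cut_size_nonneg)
  also have "\<dots> = (\<Sum>m\<in>{l, l'}. scaled_weight j m * cut_size (?A m) S)"
    using l(1) by simp
  also have "\<dots> \<le> scaled_cut i F X j S"
    unfolding scaled_cut_def
    by (rule sum_mono2) (use l in \<open>auto intro!: mult_nonneg_nonneg cut_size_nonneg scaled_weight_nonneg\<close>)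
  finally show ?thesis .
qed

lemma resample_level_tail:
  assumes j: "j < i" and n: "2 \<le> card V" and \<rho>: "\<rho> = rho (card V) \<epsilon>"
  shows "measure_pmf.prob (Pi_pmf (F (Suc j)) 0 (\<lambda>_. binomial_pmf (2 ^ Suc j) (level_prob (Suc j))))
      {r. \<exists>S\<subseteq>V. \<bar>(\<Sum>e | e \<in> F (Suc j) \<and> crosses S e. real (r e) / level_prob (Suc j)) -
        2 ^ Suc j * cut_size (F (Suc j)) S\<bar> > \<epsilon> / 13 * scaled_cut i F X j S} \<le> 4 / (real (card V))\<^sup>2"
proof -
  let ?A = "level_edges i F X"
  define q where "q e = (\<Sum>l\<in>{j..i}. if e \<in> ?A l then scaled_weight j l else 0)" for e
  have finE: "finite E" by (rule simple_graph_finite[OF E])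
  have AE: "?A l \<subseteq> E" if "l \<in> {j..i}" for l
    using level_edges_subset[of l] good_run_subset[OF run, of l] that by auto
  have Q: "cut_val q E S = scaled_cut i F X j S" for S
    unfolding q_def scaled_cut_def by (rule cut_val_levels) (use finE AE in auto)
  have \<rho>1: "1 \<le> \<rho>" unfolding \<rho> by (rule rho_ge(2)[OF n \<epsilon>])
  have ln: "0 \<le> ln (real (card V))" using n by simp
  have FA: "F (Suc j) \<subseteq> ?A (Suc j)" using good_runD(2)[OF run, of "Suc j"] j
    by (cases "Suc j = i") (simp_all add: level_edges_def)
  have "measure_pmf.prob (Pi_pmf (F (Suc j)) 0 (\<lambda>_. binomial_pmf (2 ^ Suc j) (level_prob (Suc j))))
      {r. \<exists>S\<subseteq>V. \<bar>(\<Sum>e | e \<in> F (Suc j) \<and> crosses S e. real (r e) / level_prob (Suc j)) -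
        real (2 ^ Suc j) * cut_size (F (Suc j)) S\<bar> > \<epsilon> / 13 * cut_val q E S} \<le> 4 / (real (card V))\<^sup>2"
  proof (rule binomial_sample_cuts[OF E _ n, where k = "72 / 169 * \<rho> * 4 ^ Suc j"])
    show "F (Suc j) \<subseteq> E" using FA AE[of "Suc j"] j by auto
    show "0 \<le> q e" for e unfolding q_def by (intro sum_nonneg) (simp add: scaled_weight_def)
    show "72 / 169 * \<rho> * 4 ^ Suc j \<le> cut_val q E S" if "e \<in> F (Suc j)" "S \<subseteq> V" "crosses S e" for e S
      unfolding Q by (rule scaled_cut_heavy) (use that j \<rho>1 in auto)
    \<comment> \<open>The reference graph contains level \<open>Suc j\<close> at its full weight
      \<open>2 ^ Suc j\<close>.\<close>
    show "real (2 ^ Suc j) * cut_size (F (Suc j)) S \<le> cut_val q E S" for S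
    proof -
      have "(4::real) ^ Suc j = 2 ^ Suc j * 2 ^ Suc j" by (simp flip: power_mult_distrib)
      then have "scaled_weight j (Suc j) = 2 ^ Suc j" by (simp add: scaled_weight_def)
      then have "real (2 ^ Suc j) * cut_size (F (Suc j)) S \<le> scaled_weight j (Suc j) * cut_size (?A (Suc j)) S"
        using cut_size_mono[OF _ FA] finite_subset[OF AE finE, of "Suc j"] j by (simp add: mult_left_mono)
      also have "\<dots> = (\<Sum>l\<in>{Suc j}. scaled_weight j l * cut_size (?A l) S)" by simp
      also have "\<dots> \<le> scaled_cut i F X j S"
        unfolding scaled_cut_def
        by (rule sum_mono2) (use j in \<open>auto intro!: mult_nonneg_nonneg cut_size_nonneg scaled_weight_nonneg\<close>)
      finally show ?thesis unfolding Q .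
    qed
    show "6 * ln (real (card V)) \<le> (\<epsilon> / 13)\<^sup>2 * level_prob (Suc j) / 4 * (72 / 169 * \<rho> * 4 ^ Suc j)"
    proof -
      \<comment> \<open>28561 is \<open>13^4\<close>, from the squared error and the 169 of the
        heaviness bound; 2668 * 72 / 28561 is about 6.7. The factor inserted below is at least
        1.\<close>
      have "6 * ln (real (card V)) \<le> 2668 * 72 / 28561 * ln (real (card V))" using ln by simp
      also have "\<dots> = \<epsilon>\<^sup>2 / 28561 * 72 * (2668 * ln (real (card V)) / \<epsilon>\<^sup>2)" using \<epsilon> by simp
      also have "\<dots> \<le> \<epsilon>\<^sup>2 / 28561 * 72 * \<rho>"
        unfolding \<rho> by (intro mult_left_mono rho_ge(1)[OF n \<epsilon>]) simp
      also have "\<dots> \<le> \<epsilon>\<^sup>2 / 28561 * 72 * \<rho> * (level_prob (Suc j) * 4 ^ Suc j / 4)"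
        using mult_left_mono[of 1 "level_prob (Suc j) * 4 ^ Suc j / 4" "\<epsilon>\<^sup>2 / 28561 * 72 * \<rho>"]
          level_prob_bounds(3)[of j] \<rho>1 by simp
      also have "\<dots> = (\<epsilon> / 13)\<^sup>2 * level_prob (Suc j) / 4 * (72 / 169 * \<rho> * 4 ^ Suc j)"
        by (simp add: power_divide)
      finally show ?thesis .
    qed
  qed (use \<epsilon> \<rho>1 level_prob_bounds in auto)
  then show ?thesis unfolding Q by simp
qed

end

section \<open>The output graph\<close>

lemma cut_weight_uniform: "cut_weight (uniform_weight 1 E) S = cut_size E S"
proof -
  have "dom (uniform_weight 1 E) = E" by (auto simp: uniform_weight_def add_edges_def dom_def)
  then show ?thesis
    unfolding cut_weight_def cut_size_def by (simp add: uniform_weight_def add_edges_def)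
qed

lemma cut_weight_add_edges:
  assumes "finite Y" "finite F" "Y \<inter> F = {}"
  shows "cut_weight (add_edges Y c (uniform_weight 1 F)) S = c * cut_size Y S + cut_size F S"
    "dom (add_edges Y c (uniform_weight 1 F)) = Y \<union> F"
proof -
  show dom: "dom (add_edges Y c (uniform_weight 1 F)) = Y \<union> F"
    by (auto simp: uniform_weight_def add_edges_def dom_def)
  have "cut_weight (add_edges Y c (uniform_weight 1 F)) S =
      (\<Sum>e\<in>{e \<in> Y. crosses S e} \<union> {e \<in> F. crosses S e}. if e \<in> Y then c else 1)"
    unfolding cut_weight_def dom
    by (rule sum.cong) (auto simp: uniform_weight_def add_edges_def)
  also have "\<dots> = (\<Sum>e | e \<in> Y \<and> crosses S e. if e \<in> Y then c else 1) +
      (\<Sum>e | e \<in> F \<and> crosses S e. if e \<in> Y then c else 1)"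
    by (rule sum.union_disjoint) (use assms in auto)
  also have "(\<Sum>e | e \<in> Y \<and> crosses S e. if e \<in> Y then c else 1) = (\<Sum>e | e \<in> Y \<and> crosses S e. c)"
    by (rule sum.cong) auto
  also have "(\<Sum>e | e \<in> F \<and> crosses S e. if e \<in> Y then c else 1) = (\<Sum>e | e \<in> F \<and> crosses S e. 1)"
    by (rule sum.cong) (use assms(3) in auto)
  finally show "cut_weight (add_edges Y c (uniform_weight 1 F)) S = c * cut_size Y S + cut_size F S"
    by (simp add: cut_size_def mult.commute)
qed

text \<open>Resampling is centred at the compressed graph, which is within 6 / 13 \<epsilon> of
  \<open>G\<close> and hence at most 3 / 2 of it. The level errors sum to at most \<epsilon> / 13 *
  7 / 3 * 3 / 2 = 7 / 26 \<epsilon>, so the total is 19 / 26 \<epsilon>.\<close>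

lemma resample_good:
  assumes E: "simple_graph V E" and \<epsilon>: "0 < \<epsilon>" "\<epsilon> \<le> 1" and n: "2 \<le> card V" and \<rho>: "\<rho> = rho (card V) \<epsilon>"
    and run: "good_run V E \<epsilon> \<rho> i (F(0 := F0)) X" and i: "i \<le> card V" and Y: "Y = X i - (F(0 := F0)) i"
  shows "1 - 4 / real (card V) \<le> measure_pmf.prob
    (resample F i (add_edges Y (2 ^ i) (uniform_weight 1 F0))) {G. cut_approx V \<epsilon> G (uniform_weight 1 E)}"
proof -
  let ?n = "real (card V)"
  let ?F = "F(0 := F0)"
  let ?W = "add_edges Y (2 ^ i) (uniform_weight 1 F0)"
  let ?Z = "compressed_cut ?F X"
  let ?T = "\<lambda>j S. \<epsilon> / 13 * scaled_cut i ?F X j S"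
  note run_decreasing' = run_decreasing[OF E \<epsilon> run]
  have FX: "?F j \<subseteq> X j" if "j \<le> i" for j by (rule good_runD(2)[OF run that])
  have finX: "finite (X j)" if "j \<le> i" for j by (rule run_finite[OF E \<epsilon> run that])
  have finY: "finite Y" unfolding Y using finX by simp
  have finF: "finite (?F j)" if "j \<le> i" for j using FX[OF that] finX[OF that] finite_subset by blast
  have disj: "?F j \<inter> ?F l = {}" if "j < l" "l \<le> i" for j l
    using run_decreasing'[OF that] FX[of l] that by auto
  have disjY: "Y \<inter> ?F j = {}" if "j \<le> i" for j
    using run_decreasing'[of j i] that unfolding Y by (cases "j = i") auto
  have finF0: "finite F0" and disjF0: "Y \<inter> F0 = {}" using finF[of 0] disjY[of 0] by simp_all
  note W = cut_weight_add_edges[OF finY finF0 disjF0, of "2 ^ i"]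
  \<comment> \<open>The edges kept with fixed weight and the means of the resampled levels together
    make up the compressed graph.\<close>
  have total: "cut_weight ?W S + (\<Sum>j<i. 2 ^ Suc j * cut_size (F (Suc j)) S) = ?Z i S" for S
  proof -
    have "(\<Sum>l<Suc i. 2 ^ l * cut_size (?F l) S) = cut_size F0 S + (\<Sum>j<i. 2 ^ Suc j * cut_size (F (Suc j)) S)"
      by (subst sum.lessThan_Suc_shift) simp
    moreover have "?Z i S = (\<Sum>l<Suc i. 2 ^ l * cut_size (?F l) S) + 2 ^ i * cut_size Y S"
      unfolding compressed_cut_def run_split[OF E \<epsilon> run order_refl] Y sum.lessThan_Suc
      by (simp only: distrib_left add.assoc)
    ultimately show ?thesis unfolding W(1) by simp
  qed
  have "1 - real i * (4 / ?n\<^sup>2) \<le> measure_pmf.prob (resample F i ?W)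
      {G. \<forall>S\<subseteq>V. \<bar>cut_weight G S - (cut_weight ?W S + (\<Sum>j<i. 2 ^ Suc j * cut_size (F (Suc j)) S))\<bar> \<le> (\<Sum>j<i. ?T j S)}"
  proof (rule resample_cuts)
    show "finite (dom ?W)" unfolding W(2) using finY finF0 by simp
    show "finite (F (Suc j))" if "j < i" for j using finF[of "Suc j"] that by simp
    show "F (Suc j) \<inter> F (Suc l) = {}" if "j < l" "l < i" for j l
      using disj[of "Suc j" "Suc l"] that by simp
    show "dom ?W \<inter> F (Suc j) = {}" if "j < i" for j
      unfolding W(2) using disjY[of "Suc j"] disj[of 0 "Suc j"] that by auto
    show "measure_pmf.prob (Pi_pmf (F (Suc j)) 0 (\<lambda>_. binomial_pmf (2 ^ Suc j) (level_prob (Suc j))))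
        {r. \<exists>S\<subseteq>V. \<bar>(\<Sum>e | e \<in> F (Suc j) \<and> crosses S e. real (r e) / level_prob (Suc j)) -
          2 ^ Suc j * cut_size (F (Suc j)) S\<bar> > ?T j S} \<le> 4 / ?n\<^sup>2" if "j < i" for j
      using resample_level_tail[OF E \<epsilon> run that n \<rho>] by simp
  qed simp
  also have "\<dots> \<le> measure_pmf.prob (resample F i ?W) {G. cut_approx V \<epsilon> G (uniform_weight 1 E)}"
  proof (rule measure_pmf.finite_measure_mono; safe?)
    fix G
    assume *: "\<forall>S\<subseteq>V. \<bar>cut_weight G S - (cut_weight ?W S + (\<Sum>j<i. 2 ^ Suc j * cut_size (F (Suc j)) S))\<bar>
      \<le> (\<Sum>j<i. ?T j S)"
    show "cut_approx V \<epsilon> G (uniform_weight 1 E)"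
      unfolding cut_approx_def cut_weight_uniform
    proof (intro allI impI)
      fix S assume "S \<noteq> {} \<and> S \<subset> V"
      then have S: "S \<subseteq> V" by blast
      let ?C = "cut_size E S"
      have C: "0 \<le> \<epsilon> * ?C" using \<epsilon> cut_size_nonneg[of E S] by simp
      have "3 / 2 * (\<Sum>l<i. level_error \<epsilon> l) * ?C \<le> 6 / 13 * \<epsilon> * ?C"
        using sum_level_error_le[of \<epsilon> i] \<epsilon> by (intro mult_right_mono cut_size_nonneg) auto
      then have close: "\<bar>?Z i S - ?C\<bar> \<le> 6 / 13 * (\<epsilon> * ?C)"
        using compressed_cut_close[OF E \<epsilon> run S order_refl] by linarith
      moreover have "\<epsilon> * ?C \<le> ?C" using \<epsilon> cut_size_nonneg[of E S] mult_right_mono[of \<epsilon> 1 ?C] by simp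
      ultimately have Z: "?Z i S \<le> 3 / 2 * ?C" using cut_size_nonneg[of E S] by linarith
      have "\<bar>cut_weight G S - ?Z i S\<bar> \<le> \<epsilon> / 13 * (\<Sum>j<i. scaled_cut i ?F X j S)"
        using *[rule_format, OF S] unfolding total by (simp only: sum_distrib_left)
      also have "\<dots> \<le> \<epsilon> / 13 * (7 / 3 * (3 / 2 * ?C))"
        using sum_scaled_cut_le[OF E \<epsilon> run, of S] Z \<epsilon> by (intro mult_left_mono) linarith+
      also have "\<dots> = 7 / 26 * (\<epsilon> * ?C)" by simp
      finally have "\<bar>cut_weight G S - ?C\<bar> \<le> \<epsilon> * ?C" using close C by linarith
      then show "(1 - \<epsilon>) * ?C \<le> cut_weight G S \<and> cut_weight G S \<le> (1 + \<epsilon>) * ?C"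
        by (simp add: algebra_simps abs_le_iff)
    qed
  qed simp
  finally have "1 - real i * (4 / ?n\<^sup>2) \<le> measure_pmf.prob (resample F i ?W) {G. cut_approx V \<epsilon> G (uniform_weight 1 E)}" .
  moreover have "real i * (4 / ?n\<^sup>2) \<le> ?n * (4 / ?n\<^sup>2)"
    using i by (intro mult_right_mono) auto
  moreover have "?n * (4 / ?n\<^sup>2) = 4 / ?n" using n by (simp add: power2_eq_square)
  ultimately show ?thesis by linarith
qed

theorem mainTheorem1:
  fixes V :: "'a set" and E :: "'a set set" and \<epsilon> :: real
    and NI :: "('a set, 'a set) forest_procedure"
  assumes "simple_graph V E"
    and "0 < \<epsilon>" and "\<epsilon> \<le> 1"
    and "NI_procedure NI"
  shows "measure (measure_spmf (sparsify NI V E \<epsilon>))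
           {G\<^sub>\<epsilon>. cut_approx V \<epsilon> G\<^sub>\<epsilon> (uniform_weight 1 E)}
         \<ge> 1 - 8 / real (card V)"
proof -
  let ?n = "real (card V)"
  let ?ok = "{G. cut_approx V \<epsilon> G (uniform_weight 1 E)}"
  define \<rho> where "\<rho> = rho (card V) \<epsilon>"
  have finV: "finite V" using assms(1) by (simp add: simple_graph_def)
  consider "real (card E) \<le> 2 * \<rho> * ?n" | "card V = 1" | "2 \<le> card V" "\<not> real (card E) \<le> 2 * \<rho> * ?n"
  proof -
    \<comment> \<open>On an empty vertex set division by 0 makes the claimed bound 1; there are no
      edges, so the output is \<open>G\<close> itself.\<close>
    have "real (card E) \<le> 2 * \<rho> * ?n" if "card V = 0"
    proof -
      have "E = {}" using that finV assms(1) by (auto simp: simple_graph_def)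
      then show ?thesis using that by simp
    qed
    then show ?thesis using that by (cases "card V" rule: nat.exhaust) (fastforce simp: Suc_le_eq)+
  qed
  then show ?thesis
  proof cases
    case 1
    have "cut_approx V \<epsilon> (uniform_weight 1 E) (uniform_weight 1 E)"
      using assms(2) cut_size_nonneg[of E]
      by (auto simp: cut_approx_def cut_weight_uniform algebra_simps)
    then have "measure (measure_spmf (sparsify NI V E \<epsilon>)) ?ok = 1"
      using 1 by (simp add: sparsify_def \<rho>_def measure_spmf_return_spmf measure_return)
    then show ?thesis by simp
  next
    case 2
    then have "1 - 8 / ?n \<le> 0" by simp
    then show ?thesis using measure_nonneg order_trans by blast
  next
    case 3
    define F0 where "F0 = (\<Union>j\<in>{j. 1 \<le> j \<and> real j \<le> 2 * \<rho>}. NI (block_graph V E) j)"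
    define good where "good = {(i', F', Y'). i' \<le> card V \<and>
      (\<exists>X'. good_run V E \<epsilon> \<rho> i' (F'(0 := F0)) X' \<and> Y' = X' i' - (F'(0 := F0)) i')}"
    have \<rho>1: "1 \<le> \<rho>" unfolding \<rho>_def by (rule rho_ge(2)[OF 3(1) assms(2,3)])
    have "F0 \<subseteq> E"
    proof -
      have "NI_forests (block_graph V E) (NI (block_graph V E))"
        using assms(4) represents_loopless[OF assms(1) represents_block_graph[OF assms(1)]]
        unfolding NI_procedure_def by blast
      then have "(\<Union>j\<in>{1..}. NI (block_graph V E) j) = E"
        unfolding NI_forests_def by (simp add: block_graph_def)
      then show ?thesis unfolding F0_def by auto
    qed
    \<comment> \<open>The cutoff \<open>2 * \<rho>\<close> of the initial forests is the threshold
      \<open>\<rho> * 2 ^ (j + 1)\<close> at level \<open>j = 0\<close>.\<close>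
    moreover have "\<rho> * 2 \<le> cut_size E S" if "e \<in> E" "e \<notin> F0" "crosses S e" for e S
      using initial_forests_heavy[OF assms(1,4), of "2 * \<rho>" e S] that \<rho>1
      unfolding F0_def cut_size_def by (simp add: mult.commute)
    ultimately have run: "good_run V E \<epsilon> \<rho> 0 ((\<lambda>_. {})(0 := F0)) (\<lambda>_. E)"
      unfolding good_run_def by auto
    have "1 - ?n * (4 / ?n\<^sup>2) \<le> measure (measure_spmf (level_loop NI V \<rho> 0 (\<lambda>_. {}) (E - F0))) good"
      using level_loop_good[OF assms(1,4,2,3) 3(1) \<rho>_def run] 3(1) unfolding good_def by simp
    moreover have "?n * (4 / ?n\<^sup>2) = 4 / ?n" using 3(1) by (simp add: power2_eq_square)
    ultimately have loop: "1 - 4 / ?n \<le> measure (measure_spmf (level_loop NI V \<rho> 0 (\<lambda>_. {}) (E - F0))) good"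
      by simp
    \<comment> \<open>One share of the failure probability for the halvings and one for the
      resampling.\<close>
    have "1 - (4 / ?n + 4 / ?n) \<le> measure (measure_spmf
        (bind_spmf (level_loop NI V \<rho> 0 (\<lambda>_. {}) (E - F0)) (\<lambda>(i, F, Y).
          spmf_of_pmf (resample F i (add_edges Y (2 ^ i) (uniform_weight 1 F0)))))) ?ok"
    proof (rule spmf_prob_bind_ge[OF loop])
      fix x assume "x \<in> good"
      then obtain i F Y X where x: "x = (i, F, Y)" "i \<le> card V" "good_run V E \<epsilon> \<rho> i (F(0 := F0)) X"
        "Y = X i - (F(0 := F0)) i" unfolding good_def by blast
      show "1 - 4 / ?n \<le> measure (measure_spmf (case x of (i, F, Y) \<Rightarrow>
          spmf_of_pmf (resample F i (add_edges Y (2 ^ i) (uniform_weight 1 F0))))) ?ok"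
        using resample_good[OF assms(1-3) 3(1) \<rho>_def x(3,2,4)] by (simp add: x(1))
    qed simp
    then show ?thesis
      using 3(2) unfolding sparsify_def \<rho>_def[symmetric] Let_def F0_def[symmetric] by simp
  qed
qed

end
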